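(* Let $\{\mu_1,\dots,\mu_n\}$ be a conformal $n$-deformation ($n\geq 1$) of a commutative associative conformal algebra $(A,\circ_\lambda)$. Then the map $\theta_n\in C^3_{\mathrm H}(A,A)$ defined by $$\{a_\lambda b_\mu c\}_{\theta_n}=\sum_{r+s=n+1,\ r,s\ge1}\Big(\{{\{a_\lambda b\}_{\mu_s}}_{\lambda+\mu}c\}_{\mu_r}-\{a_\lambda\{b_\mu c\}_{\mu_s}\}_{\mu_r}\Big),\qquad a,b,c\in A,$$ is a $3$-cocycle, i.e. $\mathrm d_{\mathrm H}\theta_n=0$. Moreover, the conformal $n$-deformation $\{\mu_1,\dots,\mu_n\}$ extends to some conformal $(n+1)$-deformation $\{\mu_1,\dots,\mu_n,\mu_{n+1}\}$ of $(A,\circ_\lambda)$ if and only if $[\theta_n]=0$ in $H^3_{\mathrm H}(A,A)$.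
   Context: All vector spaces are over $\mathbb{C}$. A conformal algebra is a $\mathbb{C}[\partial]$-module $A$ with a $\mathbb{C}$-bilinear map $A\times A\to A[\lambda]$, $(a,b)\mapsto a_\lambda b$, such that $(\partial a)_\lambda b=-\lambda\, a_\lambda b$ and $a_\lambda(\partial b)=(\partial+\lambda)(a_\lambda b)$. An associative conformal algebra is a conformal algebra $(A,\circ_\lambda)$ with $a\circ_\lambda(b\circ_\mu c)=(a\circ_\lambda b)\circ_{\lambda+\mu}c$; it is commutative if $a\circ_\lambda b=b\circ_{-\lambda-\partial}a$ (with $\partial$ moved to the left, acting on coefficients). Cohomology. For $k\ge1$, $C^k_{\mathrm H}(A,A)$ is the space of $k$-$\lambda$-brackets on $A$, i.e. linear maps $\gamma:A^{\otimes k}\to\mathbb{C}[\lambda_1,\dots,\lambda_{k-1}]\otimes A$, written $a_1\otimes\cdots\otimes a_k\mapsto\{a_{1\,\lambda_1}\cdots a_{k-1\,\lambda_{k-1}}a_k\}_\gamma$, with $$\{a_{1\,\lambda_1}\cdots(\partial a_i)_{\lambda_i}\cdots a_k\}_\gamma=-\lambda_i\{a_{1\,\lambda_1}\cdots a_k\}_\gamma\ (1\le i\le k-1),\qquad \{a_{1\,\lambda_1}\cdots a_{k-1\,\lambda_{k-1}}(\partial a_k)\}_\gamma=(\lambda_1+\cdots+\lambda_{k-1}+\partial)\{a_{1\,\lambda_1}\cdots a_k\}_\gamma.$$ The differential $\mathrm d_{\mathrm H}:C^k_{\mathrm H}(A,A)\to C^{k+1}_{\mathrm H}(A,A)$ is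 $$\{a_{1\,\lambda_1}\cdots a_{k\,\lambda_k}a_{k+1}\}_{\mathrm d_{\mathrm H}\gamma}=a_1\circ_{\lambda_1}\{a_{2\,\lambda_2}\cdots a_{k\,\lambda_k}a_{k+1}\}_\gamma+\sum_{i=1}^k(-1)^i\{a_{1\,\lambda_1}\cdots(a_i\circ_{\lambda_i}a_{i+1})_{\lambda_i+\lambda_{i+1}}\cdots a_{k+1}\}_\gamma+(-1)^{k+1}\{a_{1\,\lambda_1}\cdots a_{k-1\,\lambda_{k-1}}a_k\}_\gamma\circ_{\lambda_1+\cdots+\lambda_k}a_{k+1}$$ (for $i=k$ the product $a_k\circ_{\lambda_k}a_{k+1}$ stands in the last slot, without subscript). $H^3_{\mathrm H}(A,A)=\ker(\mathrm d_{\mathrm H}|_{C^3_{\mathrm H}})/\mathrm d_{\mathrm H}(C^2_{\mathrm H})$. Deformations. A conformal $n$-deformation of $(A,\circ_\lambda)$, denoted $\{\mu_1,\dots,\mu_n\}$, is a sequence of bilinear maps $\mu_i:A\times A\to A[\lambda]$, $(a,b)\mapsto\{a_\lambda b\}_{\mu_i}$, $0\le i\le n$, with $\mu_0=\circ_\lambda$ and each $\mu_i$ making $A$ a conformal algebra, such that the $\mathbb{C}[[\hbar]]/\hbar^{n+1}\mathbb{C}[[\hbar]]$-bilinear $\lambda$-operation on $A[[\hbar]]/\hbar^{n+1}A[[\hbar]]$ determined by $a\circ^\hbar_\lambda b=\sum_{k=0}^n\hbar^k\{a_\lambda b\}_{\mu_k}$ ($a,b\in A$) is an associative conformal algebra operation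 (not required to be commutative). A conformal $(n+1)$-deformation $\{\mu_1,\dots,\mu_n,\mu_{n+1}\}$ with the same first $n$ terms is called an extension of $\{\mu_1,\dots,\mu_n\}$. *)

theory Defs
  imports Complex_Main "HOL-Library.Poly_Mapping"
    "HOL-Computational_Algebra.Polynomial" "HOL-Computational_Algebra.Formal_Power_Series"
begin

section \<open>Modules over the polynomial ring in the derivation\<close>

text \<open>A module over $\mathbf{C}[\partial]$ is a complex vector space with a linear endomorphism.\<close>

class del_module = ab_group_add +
  fixes scaleC :: "complex \<Rightarrow> 'a \<Rightarrow> 'a"  (infixr \<open>*\<^sub>C\<close> 75)
    and del :: "'a \<Rightarrow> 'a"  (\<open>\<partial>\<close>)
  assumes scaleC_add_right: "c *\<^sub>C (x + y) = c *\<^sub>C x + c *\<^sub>C y"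
    and scaleC_add_left: "(c + d) *\<^sub>C x = c *\<^sub>C x + d *\<^sub>C x"
    and scaleC_scaleC: "c *\<^sub>C (d *\<^sub>C x) = (c * d) *\<^sub>C x"
    and scaleC_one: "1 *\<^sub>C x = x"
    and del_add: "\<partial> (x + y) = \<partial> x + \<partial> y"
    and del_scaleC: "\<partial> (c *\<^sub>C x) = c *\<^sub>C \<partial> x"

text \<open>The coefficientwise structure on $A[[\hbar]]$.\<close>

instantiation fps :: (del_module) del_module
begin

definition scaleC_fps :: "complex \<Rightarrow> 'a fps \<Rightarrow> 'a fps" where
  "c *\<^sub>C f = Abs_fps (\<lambda>i. c *\<^sub>C fps_nth f i)"

definition del_fps :: "'a fps \<Rightarrow> 'a fps" where
  "\<partial> f = Abs_fps (\<lambda>i. \<partial> (fps_nth f i))"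

instance
  by standard
    (simp_all add: fps_eq_iff scaleC_fps_def del_fps_def scaleC_add_right scaleC_add_left
      scaleC_scaleC scaleC_one del_add del_scaleC)

end

definition submodule :: "'v::del_module set \<Rightarrow> bool" where
  "submodule V \<longleftrightarrow> 0 \<in> V \<and> (\<forall>x\<in>V. \<forall>y\<in>V. x + y \<in> V) \<and> (\<forall>c. \<forall>x\<in>V. c *\<^sub>C x \<in> V)
     \<and> (\<forall>x\<in>V. \<partial> x \<in> V)"


section \<open>Polynomials in several variables with coefficients in a module\<close>

text \<open>The indeterminates are numbered from $0$: the variable attached to the argument with
  list index $i$ is \<open>lam i\<close>.\<close>

type_synonym scalar_mpoly = "(nat \<Rightarrow>\<^sub>0 nat) \<Rightarrow>\<^sub>0 complex"
type_synonym 'v mpoly = "(nat \<Rightarrow>\<^sub>0 nat) \<Rightarrow>\<^sub>0 'v"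

definition lam :: "nat \<Rightarrow> scalar_mpoly" where
  "lam i = Poly_Mapping.single (Poly_Mapping.single i 1) 1"

definition cst :: "'v::del_module \<Rightarrow> 'v mpoly" where
  "cst a = Poly_Mapping.single 0 a"

text \<open>The action of $\mathbf{C}[\lambda_0,\lambda_1,\dots]$ on $A[\lambda_0,\lambda_1,\dots]$.\<close>

definition act :: "scalar_mpoly \<Rightarrow> 'v::del_module mpoly \<Rightarrow> 'v mpoly"  (infixr \<open>\<bullet>\<close> 75) where
  "p \<bullet> F = (\<Sum>u\<in>Poly_Mapping.keys p. \<Sum>v\<in>Poly_Mapping.keys F. Poly_Mapping.single (u + v) (Poly_Mapping.lookup p u *\<^sub>C Poly_Mapping.lookup F v))"

definition mpoly_del :: "'v::del_module mpoly \<Rightarrow> 'v mpoly" where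
  "mpoly_del F = Poly_Mapping.map \<partial> F"

text \<open>Substitution of \<open>\<sigma> i\<close> for \<open>lam i\<close>, for all \<open>i\<close> simultaneously.\<close>

definition msubst :: "(nat \<Rightarrow> scalar_mpoly) \<Rightarrow> 'v::del_module mpoly \<Rightarrow> 'v mpoly" where
  "msubst \<sigma> F = (\<Sum>u\<in>Poly_Mapping.keys F. (\<Prod>i\<in>Poly_Mapping.keys u. \<sigma> i ^ Poly_Mapping.lookup u i) \<bullet> cst (Poly_Mapping.lookup F u))"

definition poly_at :: "scalar_mpoly \<Rightarrow> 'v::del_module poly \<Rightarrow> 'v mpoly" where
  "poly_at p F = (\<Sum>j\<le>degree F. p ^ j \<bullet> cst (coeff F j))"

text \<open>\<open>lbr m p F G\<close> is $\{F_{\,p}\,G\}_m$: the bracket is extended bilinearly over the scalar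
  polynomials to arguments with polynomial coefficients, and evaluated at $\lambda = p$.\<close>

definition lbr :: "('v \<Rightarrow> 'v \<Rightarrow> 'v poly) \<Rightarrow> scalar_mpoly \<Rightarrow> 'v::del_module mpoly \<Rightarrow> 'v mpoly \<Rightarrow> 'v mpoly" where
  "lbr m p F G = (\<Sum>u\<in>Poly_Mapping.keys F. \<Sum>v\<in>Poly_Mapping.keys G.
     Poly_Mapping.single (u + v) 1 \<bullet> poly_at p (m (Poly_Mapping.lookup F u) (Poly_Mapping.lookup G v)))"


section \<open>Conformal algebras\<close>

text \<open>The underlying module is a submodule \<open>V\<close> of the ambient type, so that the notion also applies
  to $A[[\hbar]]/(\hbar^{n+1})$; values of the operation outside \<open>V\<close> are irrelevant.
  Multiplication by $\lambda$ on $V[\lambda]$ is \<open>pCons 0\<close>.\<close>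

definition conformal_algebra :: "'v::del_module set \<Rightarrow> ('v \<Rightarrow> 'v \<Rightarrow> 'v poly) \<Rightarrow> bool" where
  "conformal_algebra V m \<longleftrightarrow> submodule V
    \<and> (\<forall>a\<in>V. \<forall>b\<in>V. \<forall>j. coeff (m a b) j \<in> V)
    \<and> (\<forall>a\<in>V. \<forall>a'\<in>V. \<forall>b\<in>V. m (a + a') b = m a b + m a' b)
    \<and> (\<forall>a\<in>V. \<forall>b\<in>V. \<forall>b'\<in>V. m a (b + b') = m a b + m a b')
    \<and> (\<forall>c. \<forall>a\<in>V. \<forall>b\<in>V. m (c *\<^sub>C a) b = map_poly ((*\<^sub>C) c) (m a b))
    \<and> (\<forall>c. \<forall>a\<in>V. \<forall>b\<in>V. m a (c *\<^sub>C b) = map_poly ((*\<^sub>C) c) (m a b))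
    \<and> (\<forall>a\<in>V. \<forall>b\<in>V. m (\<partial> a) b = - pCons 0 (m a b))
    \<and> (\<forall>a\<in>V. \<forall>b\<in>V. m a (\<partial> b) = map_poly \<partial> (m a b) + pCons 0 (m a b))"

definition associative_conformal_algebra :: "'v::del_module set \<Rightarrow> ('v \<Rightarrow> 'v \<Rightarrow> 'v poly) \<Rightarrow> bool" where
  "associative_conformal_algebra V m \<longleftrightarrow> conformal_algebra V m
    \<and> (\<forall>a\<in>V. \<forall>b\<in>V. \<forall>c\<in>V.
         lbr m (lam 0) (cst a) (lbr m (lam 1) (cst b) (cst c))
         = lbr m (lam 0 + lam 1) (lbr m (lam 0) (cst a) (cst b)) (cst c))"

text \<open>\<open>poly_at_minus_lam_del F\<close> is $F$ at $-\lambda-\partial$, i.e.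
  $\sum_j (-\lambda-\partial)^j f_j$ where $F = \sum_j \lambda^j f_j$.\<close>

definition poly_at_minus_lam_del :: "'v::del_module poly \<Rightarrow> 'v poly" where
  "poly_at_minus_lam_del F =
     (\<Sum>j\<le>degree F. ((\<lambda>G. - pCons 0 G - map_poly \<partial> G) ^^ j) [:coeff F j:])"

definition commutative_on :: "'v::del_module set \<Rightarrow> ('v \<Rightarrow> 'v \<Rightarrow> 'v poly) \<Rightarrow> bool" where
  "commutative_on V m \<longleftrightarrow> (\<forall>a\<in>V. \<forall>b\<in>V. m a b = poly_at_minus_lam_del (m b a))"


section \<open>Cohomology\<close>

text \<open>A linear map on $A^{\otimes k}$ is given as a multilinear function on lists of length \<open>k\<close>;
  by convention it is $0$ on all other lists, so that equality of cochains is equality of functions.\<close>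

definition cochains :: "nat \<Rightarrow> ('a::del_module list \<Rightarrow> 'a mpoly) set" where
  "cochains k = {\<gamma>.
     (\<forall>as. length as \<noteq> k \<longrightarrow> \<gamma> as = 0) \<and>
     (\<forall>as. length as = k \<longrightarrow>
        (\<forall>u\<in>Poly_Mapping.keys (\<gamma> as). Poly_Mapping.keys u \<subseteq> {..<k - 1}) \<and>
        (\<forall>i<k. \<forall>x y. \<gamma> (as[i := x + y]) = \<gamma> (as[i := x]) + \<gamma> (as[i := y])) \<and>
        (\<forall>i<k. \<forall>c x. \<gamma> (as[i := c *\<^sub>C x]) = Poly_Mapping.map ((*\<^sub>C) c) (\<gamma> (as[i := x]))) \<and>
        (\<forall>i<k - 1. \<gamma> (as[i := \<partial> (as ! i)]) = (- lam i) \<bullet> \<gamma> as) \<and>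
        \<gamma> (as[k - 1 := \<partial> (as ! (k - 1))]) = (\<Sum>i<k - 1. lam i) \<bullet> \<gamma> as + mpoly_del (\<gamma> as))}"

text \<open>In the \<open>i\<close>-th summand of the middle sum, the product of \<open>as ! i\<close> and \<open>as ! Suc i\<close> is inserted
  coefficient by coefficient. For \<open>i = k - 1\<close> it stands in the last slot, which carries no variable;
  then \<open>\<gamma>\<close> involves \<open>lam j\<close> for \<open>j < i\<close> only, so the other branches of the substitution are idle.\<close>

definition dH :: "('a \<Rightarrow> 'a \<Rightarrow> 'a poly) \<Rightarrow> nat \<Rightarrow> ('a::del_module list \<Rightarrow> 'a mpoly) \<Rightarrow> 'a list \<Rightarrow> 'a mpoly" where
  "dH m k \<gamma> as = (if length as = Suc k then
      lbr m (lam 0) (cst (as ! 0)) (msubst (\<lambda>j. lam (Suc j)) (\<gamma> (tl as)))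
      + (\<Sum>i<k. (- 1) ^ Suc i \<bullet>
          (let P = m (as ! i) (as ! Suc i) in
           \<Sum>l\<le>degree P. lam i ^ l \<bullet>
             msubst (\<lambda>j. if j < i then lam j else if j = i then lam i + lam (Suc i) else lam (Suc j))
               (\<gamma> (take i as @ [coeff P l] @ drop (i + 2) as))))
      + (- 1) ^ Suc k \<bullet> lbr m (\<Sum>i<k. lam i) (\<gamma> (take k as)) (cst (as ! k))
    else 0)"

definition cocycles :: "('a \<Rightarrow> 'a \<Rightarrow> 'a poly) \<Rightarrow> nat \<Rightarrow> ('a::del_module list \<Rightarrow> 'a mpoly) set" where
  "cocycles m k = {\<gamma> \<in> cochains k. dH m k \<gamma> = (\<lambda>_. 0)}"

text \<open>Meant for \<open>k \<ge> 2\<close>, since the complex starts in degree $1$.\<close>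

definition coboundaries :: "('a \<Rightarrow> 'a \<Rightarrow> 'a poly) \<Rightarrow> nat \<Rightarrow> ('a::del_module list \<Rightarrow> 'a mpoly) set" where
  "coboundaries m k = dH m (k - 1) ` cochains (k - 1)"

definition cohomologous ::
    "('a \<Rightarrow> 'a \<Rightarrow> 'a poly) \<Rightarrow> nat \<Rightarrow> (('a::del_module list \<Rightarrow> 'a mpoly) \<times> ('a list \<Rightarrow> 'a mpoly)) set" where
  "cohomologous m k = {(\<gamma>, \<gamma>'). \<gamma> \<in> cocycles m k \<and> \<gamma>' \<in> cocycles m k
     \<and> (\<lambda>as. \<gamma> as - \<gamma>' as) \<in> coboundaries m k}"

definition cohomology ::
    "('a \<Rightarrow> 'a \<Rightarrow> 'a poly) \<Rightarrow> nat \<Rightarrow> ('a::del_module list \<Rightarrow> 'a mpoly) set set" where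
  "cohomology m k = cocycles m k // cohomologous m k"

definition cohomology_class ::
    "('a \<Rightarrow> 'a \<Rightarrow> 'a poly) \<Rightarrow> nat \<Rightarrow> ('a::del_module list \<Rightarrow> 'a mpoly) \<Rightarrow> ('a list \<Rightarrow> 'a mpoly) set" where
  "cohomology_class m k \<gamma> = cohomologous m k `` {\<gamma>}"


section \<open>Deformations\<close>

text \<open>$A[[\hbar]]/\hbar^{n+1}A[[\hbar]]$ is realised by its representatives of degree at most \<open>n\<close>.\<close>

definition truncated :: "nat \<Rightarrow> 'a::del_module fps set" where
  "truncated n = {f. \<forall>i>n. fps_nth f i = 0}"

definition hbar_times :: "nat \<Rightarrow> 'a::del_module \<Rightarrow> 'a fps" where
  "hbar_times l a = Abs_fps (\<lambda>i. if i = l then a else 0)"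

text \<open>The unique extension of $(a,b) \mapsto \sum_{k\le n} \hbar^k \{a_\lambda b\}_{\mu_k}$ that is
  bilinear over $\mathbf{C}[[\hbar]]/(\hbar^{n+1})$; terms with $\hbar^{n+1}$ or higher are dropped.\<close>

definition hbar_op ::
    "nat \<Rightarrow> (nat \<Rightarrow> 'a \<Rightarrow> 'a \<Rightarrow> 'a poly) \<Rightarrow> 'a::del_module fps \<Rightarrow> 'a fps \<Rightarrow> 'a fps poly" where
  "hbar_op n \<mu> f g = (\<Sum>(i, j, k)\<in>{(i, j, k). i + j + k \<le> n}.
     map_poly (hbar_times (i + j + k)) (\<mu> k (fps_nth f i) (fps_nth g j)))"

text \<open>The values \<open>\<mu> i\<close> for \<open>i > n\<close> are irrelevant.\<close>

definition conformal_deformation ::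
    "('a \<Rightarrow> 'a \<Rightarrow> 'a poly) \<Rightarrow> nat \<Rightarrow> (nat \<Rightarrow> 'a \<Rightarrow> 'a \<Rightarrow> 'a::del_module poly) \<Rightarrow> bool" where
  "conformal_deformation m n \<mu> \<longleftrightarrow> \<mu> 0 = m
     \<and> (\<forall>i\<le>n. conformal_algebra UNIV (\<mu> i))
     \<and> associative_conformal_algebra (truncated n) (hbar_op n \<mu>)"

definition extension_of ::
    "('a \<Rightarrow> 'a \<Rightarrow> 'a poly) \<Rightarrow> nat \<Rightarrow> (nat \<Rightarrow> 'a \<Rightarrow> 'a \<Rightarrow> 'a::del_module poly)
     \<Rightarrow> (nat \<Rightarrow> 'a \<Rightarrow> 'a \<Rightarrow> 'a poly) \<Rightarrow> bool" where
  "extension_of m n \<mu> \<mu>' \<longleftrightarrow> conformal_deformation m (Suc n) \<mu>' \<and> (\<forall>i\<le>n. \<mu>' i = \<mu> i)"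

definition theta :: "nat \<Rightarrow> (nat \<Rightarrow> 'a \<Rightarrow> 'a \<Rightarrow> 'a poly) \<Rightarrow> 'a::del_module list \<Rightarrow> 'a mpoly" where
  "theta n \<mu> as = (case as of
      [a, b, c] \<Rightarrow>
        (\<Sum>(r, s)\<in>{(r, s). r + s = n + 1 \<and> r \<ge> 1 \<and> s \<ge> 1}.
           lbr (\<mu> r) (lam 0 + lam 1) (lbr (\<mu> s) (lam 0) (cst a) (cst b)) (cst c)
           - lbr (\<mu> r) (lam 0) (cst a) (lbr (\<mu> s) (lam 1) (cst b) (cst c)))
    | _ \<Rightarrow> 0)"

end

theory Submission imports Defs begin

text \<open>Write $\mu = \sum_k \hbar^k \mu_k$ and let $A_N$ be the coefficient of $\hbar^N$ in the associator
  $(ab)c - a(bc)$ of the product $\mu$ (\<open>associator\<close>). Comparing coefficients of $\hbar$ shows that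
  $\mu_1,\dots,\mu_n$ is a deformation of order $n$ iff all $\mu_k$ are conformal and $A_0 = \dots = A_n = 0$
  (\<open>hbar_op_associative_iff\<close>). In $A_{n+1}$ the bracket $\mu_{n+1}$ is composed with $\mu_0$ only, and
  collecting these terms gives $A_{n+1} = \theta_n - \mathrm{d}\mu_{n+1}$ (\<open>associator_eq_theta_minus_dH\<close>).

  Both assertions follow. For any conformal $\mu_{n+1}$ the extended sequence is a deformation iff
  $\mathrm{d}\mu_{n+1} = \theta_n$, and the conformal brackets are exactly the $2$-cochains
  (\<open>cochains_2_eq\<close>), so an extension exists iff $\theta_n$ is a coboundary. For the cocycle
  property take $\mu_k = 0$ for $k > n$, so that $\theta_n = A_{n+1}$. The associator of every bilinear
  product satisfies the five-term identity
  $a\,(b,c,d) - (ab,c,d) + (a,bc,d) - (a,b,cd) + (a,b,c)\,d = 0$ (\<open>pentagon\<close>). As $A_j = 0$ for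
  $j \le n$, its coefficient at $\hbar^{n+1}$ contains only $A_{n+1}$ and $\mu_0$, and reads
  $\mathrm{d}A_{n+1} = 0$ (\<open>dH_associator\<close>).

  The $\lambda$-parameters are carried by \<^const>\<open>lbr\<close>. It is bilinear over the scalar polynomials and
  compatible with substitution, and with these two properties nested $\lambda$-brackets can be handled like
  products in an ordinary algebra: the parameter of a bracket is the sum of the variables of
  the factors on its left-hand side, and such sums agree for the two occurrences of a bracketing.\<close>

section \<open>Linear maps and coefficientwise operations\<close>

lemma scaleC_zero_right [simp]: "c *\<^sub>C (0::'a::del_module) = 0"
  by (metis add_cancel_right_right scaleC_add_right)

lemma scaleC_zero_left [simp]: "0 *\<^sub>C (x::'a::del_module) = 0"
  by (metis add_cancel_right_right scaleC_add_left)

lemma del_zero [simp]: "\<partial> (0::'a::del_module) = 0"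
  by (metis add_cancel_right_right del_add)

declare scaleC_one [simp]

text \<open>With this structure the scalar polynomials are themselves polynomials with coefficients in a
  module, so that \<^const>\<open>msubst\<close> also acts on them; every compatibility of substitution with
  \<^const>\<open>act\<close> then specialises to multiplicativity on scalars.\<close>

instantiation complex :: del_module
begin

definition scaleC_complex :: "complex \<Rightarrow> complex \<Rightarrow> complex" where
  "c *\<^sub>C x = c * x"

definition del_complex :: "complex \<Rightarrow> complex" where
  "\<partial> x = (0::complex)"

instance
  by standard (simp_all add: scaleC_complex_def del_complex_def algebra_simps)

end

text \<open>The derivation, multiplication by a scalar and extraction of the coefficient of $\hbar^N$ are
  all of this kind, so that coefficientwise application of each commutes with the action of the
  scalar polynomials by one and the same lemma.\<close>

definition complex_linear :: "('v::del_module \<Rightarrow> 'w::del_module) \<Rightarrow> bool" where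
  "complex_linear L \<longleftrightarrow> (\<forall>x y. L (x + y) = L x + L y) \<and> (\<forall>c x. L (c *\<^sub>C x) = c *\<^sub>C L x)"

lemma complex_linear_add: "complex_linear L \<Longrightarrow> L (x + y) = L x + L y"
  and complex_linear_scaleC: "complex_linear L \<Longrightarrow> L (c *\<^sub>C x) = c *\<^sub>C L x"
  by (simp_all add: complex_linear_def)

lemma complex_linear_zero: "complex_linear L \<Longrightarrow> L 0 = 0"
  by (metis add_cancel_right_right complex_linear_add)

lemma complex_linear_sum: "complex_linear L \<Longrightarrow> L (sum f S) = (\<Sum>x\<in>S. L (f x))"
  by (induction S rule: infinite_finite_induct) (simp_all add: complex_linear_zero complex_linear_add)

lemma complex_linear_del: "complex_linear (\<partial> :: 'v::del_module \<Rightarrow> 'v)"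
  by (simp add: complex_linear_def del_add del_scaleC)

lemma complex_linear_scaleC_fun: "complex_linear (\<lambda>x::'v::del_module. c *\<^sub>C x)"
  by (simp add: complex_linear_def scaleC_add_right scaleC_scaleC mult.commute)

lemma complex_linear_fps_nth: "complex_linear (\<lambda>f::'v::del_module fps. fps_nth f N)"
  by (simp add: complex_linear_def scaleC_fps_def)

lemma mpoly_sum_single:
  fixes F :: "'k \<Rightarrow>\<^sub>0 'v::comm_monoid_add"
  shows "F = (\<Sum>u\<in>Poly_Mapping.keys F. Poly_Mapping.single u (Poly_Mapping.lookup F u))"
  by (rule poly_mapping_eqI)
    (simp add: lookup_sum lookup_single when_def sum.delta in_keys_iff)

text \<open>Additive operations agree as soon as they agree on monomials. The laws of the action, of
  substitution and of brackets all reduce to monomials in this way.\<close>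

lemma mpoly_induct [case_names zero add single]:
  fixes F :: "'k \<Rightarrow>\<^sub>0 'v::comm_monoid_add"
  assumes "P 0" "\<And>F G. P F \<Longrightarrow> P G \<Longrightarrow> P (F + G)" "\<And>u a. P (Poly_Mapping.single u a)"
  shows "P F"
proof -
  have "P (\<Sum>u\<in>S. Poly_Mapping.single u (Poly_Mapping.lookup F u))" for S
    by (induction S rule: infinite_finite_induct) (simp_all add: assms)
  then show ?thesis
    using mpoly_sum_single[of F] by metis
qed

text \<open>The operations on polynomials are defined as sums over the support of their argument.
  The support is not additive, so additivity of such an operation is obtained by summing over a
  common finite superset.\<close>

lemma sum_keys_superset:
  assumes "finite S" "Poly_Mapping.keys F \<subseteq> S" "\<And>u. f u 0 = 0"
  shows "(\<Sum>u\<in>Poly_Mapping.keys F. f u (Poly_Mapping.lookup F u)) = (\<Sum>u\<in>S. f u (Poly_Mapping.lookup F u))"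
  by (rule sum.mono_neutral_left) (use assms in \<open>auto simp: in_keys_iff\<close>)

lemma sum_keys_add:
  fixes f :: "'k \<Rightarrow> 'v::comm_monoid_add \<Rightarrow> 'w::comm_monoid_add"
  assumes z: "\<And>u. f u 0 = 0" and a: "\<And>u x y. f u (x + y) = f u x + f u y"
  shows "(\<Sum>u\<in>Poly_Mapping.keys (F + G). f u (Poly_Mapping.lookup (F + G) u)) =
    (\<Sum>u\<in>Poly_Mapping.keys F. f u (Poly_Mapping.lookup F u)) +
    (\<Sum>u\<in>Poly_Mapping.keys G. f u (Poly_Mapping.lookup G u))"
proof -
  let ?S = "Poly_Mapping.keys F \<union> Poly_Mapping.keys G"
  have "finite ?S" "Poly_Mapping.keys (F + G) \<subseteq> ?S" by (auto simp: in_keys_iff lookup_add)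
  then show ?thesis
    using z sum_keys_superset[of ?S F f] sum_keys_superset[of ?S G f] sum_keys_superset[of ?S "F+G" f]
    by (simp add: lookup_add a sum.distrib)
qed

lemma additive_zero:
  fixes T :: "'x::ab_group_add \<Rightarrow> 'y::ab_group_add"
  assumes "\<And>x y. T (x + y) = T x + T y" shows "T 0 = 0"
  by (metis add_cancel_right_right assms)

lemma additive_minus:
  fixes T :: "'x::ab_group_add \<Rightarrow> 'y::ab_group_add"
  assumes "\<And>x y. T (x + y) = T x + T y" shows "T (- x) = - T x"
  using additive_zero[of T] assms by (metis add.right_inverse add_eq_0_iff)

lemma additive_diff:
  fixes T :: "'x::ab_group_add \<Rightarrow> 'y::ab_group_add"
  assumes "\<And>x y. T (x + y) = T x + T y" shows "T (x - y) = T x - T y"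
  using additive_minus[of T] assms by (metis diff_conv_add_uminus)

lemma additive_sum:
  fixes T :: "'x::ab_group_add \<Rightarrow> 'y::ab_group_add"
  assumes "\<And>x y. T (x + y) = T x + T y" shows "T (sum f S) = (\<Sum>i\<in>S. T (f i))"
  by (induction S rule: infinite_finite_induct) (simp_all add: assms additive_zero[of T])

lemma mpoly_map_lookup: "f 0 = 0 \<Longrightarrow> Poly_Mapping.lookup (Poly_Mapping.map f F) u = f (Poly_Mapping.lookup F u)"
  by (simp add: Poly_Mapping.map.rep_eq when_def)

lemma mpoly_map_add: "complex_linear L \<Longrightarrow> Poly_Mapping.map L (F + G) = Poly_Mapping.map L F + Poly_Mapping.map L G"
  by (rule poly_mapping_eqI) (simp add: mpoly_map_lookup lookup_add complex_linear_zero complex_linear_add)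

lemma mpoly_map_zero [simp]: "Poly_Mapping.map L 0 = 0"
  by (rule poly_mapping_eqI) (simp add: Poly_Mapping.map.rep_eq)

lemma mpoly_map_cst: "complex_linear L \<Longrightarrow> Poly_Mapping.map L (cst a) = cst (L a)"
  by (rule poly_mapping_eqI) (simp add: mpoly_map_lookup complex_linear_zero cst_def lookup_single when_def)

lemma cst_add: "cst (a + b) = cst a + cst b"
  by (simp add: cst_def single_add)

lemma cst_zero [simp]: "cst 0 = 0"
  by (simp add: cst_def)

section \<open>The action of the scalar polynomials and substitution\<close>

lemma act_add_left: "(p + q) \<bullet> F = p \<bullet> F + q \<bullet> F"
  unfolding act_def
  by (rule sum_keys_add[where f = "\<lambda>u x. \<Sum>v\<in>Poly_Mapping.keys F. Poly_Mapping.single (u + v) (x *\<^sub>C Poly_Mapping.lookup F v)"])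
    (simp_all add: scaleC_add_left single_add sum.distrib)

lemma act_add_right: "p \<bullet> (F + G) = p \<bullet> F + p \<bullet> G"
  unfolding act_def sum.distrib[symmetric]
  by (rule sum.cong[OF refl], rule sum_keys_add[where f = "\<lambda>v x. Poly_Mapping.single (_ + v) (_ *\<^sub>C x)"])
    (simp_all add: scaleC_add_right single_add)

lemmas act_zero_left [simp] = additive_zero[where T="\<lambda>p. p \<bullet> F" for F, OF act_add_left]
lemmas act_zero_right [simp] = additive_zero[where T="\<lambda>F. p \<bullet> F" for p, OF act_add_right]
lemmas act_minus_left = additive_minus[where T="\<lambda>p. p \<bullet> F" for F, OF act_add_left]
lemmas act_minus_right = additive_minus[where T="\<lambda>F. p \<bullet> F" for p, OF act_add_right]
lemmas act_diff_right = additive_diff[where T="\<lambda>F. p \<bullet> F" for p, OF act_add_right]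
lemmas act_sum_right = additive_sum[where T="\<lambda>F. p \<bullet> F" for p, OF act_add_right]

lemma act_single_single:
  "Poly_Mapping.single u c \<bullet> Poly_Mapping.single v a = Poly_Mapping.single (u + v) (c *\<^sub>C a)"
  by (simp add: act_def keys_single)

lemma act_mult: "(p * q) \<bullet> F = p \<bullet> q \<bullet> F"
proof (induction p rule: mpoly_induct)
  case (single u c)
  show ?case
  proof (induction q rule: mpoly_induct)
    case (single v d)
    show ?case
      by (induction F rule: mpoly_induct)
        (simp_all add: mult_single act_single_single act_add_right scaleC_scaleC add.assoc)
  qed (simp_all add: distrib_left act_add_left act_add_right)
qed (simp_all add: distrib_right act_add_left)

lemma act_one [simp]: "1 \<bullet> F = F"
  by (induction F rule: mpoly_induct)
    (simp_all add: single_one[symmetric] act_single_single act_add_right del: single_one)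

lemma act_commute: "p \<bullet> q \<bullet> F = q \<bullet> p \<bullet> F"
  by (metis act_mult mult.commute)

lemma act_scalar: "p \<bullet> q = p * (q :: scalar_mpoly)"
proof (induction p rule: mpoly_induct)
  case (single u c)
  show ?case
    by (induction q rule: mpoly_induct)
      (simp_all add: mult_single act_single_single act_add_right distrib_left scaleC_complex_def)
qed (simp_all add: distrib_right act_add_left)

lemma single_eq_act_cst: "Poly_Mapping.single u a = Poly_Mapping.single u 1 \<bullet> cst a"
  by (simp add: cst_def act_single_single)

lemma mpoly_map_act: "complex_linear L \<Longrightarrow> Poly_Mapping.map L (p \<bullet> F) = p \<bullet> Poly_Mapping.map L F"
proof (induction p rule: mpoly_induct)
  case (single u c)
  then show ?case
    by (induction F rule: mpoly_induct)
      (simp_all add: act_single_single act_add_right mpoly_map_add complex_linear_scaleC complex_linear_zero when_def)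
qed (simp_all add: mpoly_map_add act_add_left)

lemma mpoly_map_scaleC: "Poly_Mapping.map ((*\<^sub>C) c) F = Poly_Mapping.single 0 c \<bullet> F"
  by (induction F rule: mpoly_induct)
     (simp_all add: act_single_single act_add_right mpoly_map_add complex_linear_scaleC_fun when_def)

definition monomial_value :: "(nat \<Rightarrow> scalar_mpoly) \<Rightarrow> (nat \<Rightarrow>\<^sub>0 nat) \<Rightarrow> scalar_mpoly" where
  "monomial_value \<sigma> u = (\<Prod>i\<in>Poly_Mapping.keys u. \<sigma> i ^ Poly_Mapping.lookup u i)"

text \<open>This is what makes substitution a ring homomorphism on scalars.\<close>

lemma monomial_value_add: "monomial_value \<sigma> (u + v) = monomial_value \<sigma> u * monomial_value \<sigma> v"
proof -
  let ?S = "Poly_Mapping.keys u \<union> Poly_Mapping.keys v"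
  have *: "monomial_value \<sigma> w = (\<Prod>i\<in>?S. \<sigma> i ^ Poly_Mapping.lookup w i)" if "Poly_Mapping.keys w \<subseteq> ?S" for w
    unfolding monomial_value_def
    by (rule prod.mono_neutral_left) (use that in \<open>auto simp: in_keys_iff\<close>)
  have "Poly_Mapping.keys (u + v) \<subseteq> ?S" by (auto simp: in_keys_iff lookup_add)
  then show ?thesis
    by (simp add: * lookup_add power_add prod.distrib)
qed

lemma msubst_add: "msubst \<sigma> (F + G) = msubst \<sigma> F + msubst \<sigma> G"
  unfolding msubst_def
  by (rule sum_keys_add[where f = "\<lambda>u x. (\<Prod>i\<in>Poly_Mapping.keys u. \<sigma> i ^ Poly_Mapping.lookup u i) \<bullet> cst x"])
    (simp_all add: cst_add act_add_right)

lemmas msubst_zero [simp] = additive_zero[where T="msubst \<sigma>" for \<sigma>, OF msubst_add]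
lemmas msubst_diff = additive_diff[where T="msubst \<sigma>" for \<sigma>, OF msubst_add]
lemmas msubst_sum = additive_sum[where T="msubst \<sigma>" for \<sigma>, OF msubst_add]

lemma msubst_single: "msubst \<sigma> (Poly_Mapping.single u a) = monomial_value \<sigma> u \<bullet> cst a"
  by (simp add: msubst_def monomial_value_def)

lemma msubst_cst [simp]: "msubst \<sigma> (cst a) = cst a"
  by (simp add: cst_def msubst_single monomial_value_def)

lemma msubst_lam [simp]: "msubst \<sigma> (lam i) = \<sigma> i"
  by (simp add: lam_def msubst_single monomial_value_def act_scalar cst_def)

lemma cst_scaleC: "cst (c *\<^sub>C a) = Poly_Mapping.single 0 c \<bullet> cst a"
  by (simp add: cst_def act_single_single)

lemma msubst_act: "msubst \<sigma> (p \<bullet> F) = msubst \<sigma> p \<bullet> msubst \<sigma> F"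
proof (induction p rule: mpoly_induct)
  case (single u c)
  show ?case
  proof (induction F rule: mpoly_induct)
    case (single v a)
    show ?case
      by (simp add: act_single_single msubst_single monomial_value_add cst_scaleC)
        (simp add: cst_def act_scalar act_mult[symmetric] mult_ac)
  qed (simp_all add: msubst_add act_add_right)
qed (simp_all add: msubst_add act_add_left)

lemma msubst_mult: "msubst \<sigma> (p * q) = msubst \<sigma> p * msubst \<sigma> (q::scalar_mpoly)"
  using msubst_act[of \<sigma> p q] by (simp add: act_scalar)

lemma msubst_one [simp]: "msubst \<sigma> (1::scalar_mpoly) = 1"
  using msubst_cst[of \<sigma> "1::complex"] by (simp add: cst_def)

lemma msubst_power: "msubst \<sigma> (p ^ j) = msubst \<sigma> (p::scalar_mpoly) ^ j"
  by (induction j) (simp_all add: msubst_mult)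

text \<open>A bound on the degree that serves two polynomials at once makes \<^const>\<open>poly_at\<close> additive.\<close>

lemma poly_at_superset: "degree P \<le> N \<Longrightarrow> poly_at p P = (\<Sum>j\<le>N. p ^ j \<bullet> cst (coeff P j))"
  unfolding poly_at_def by (rule sum.mono_neutral_left) (auto simp: coeff_eq_0)

lemma poly_at_add: "poly_at p (P + Q) = poly_at p P + poly_at p Q"
proof -
  let ?N = "max (degree P) (degree Q)"
  have "degree (P + Q) \<le> ?N" by (rule degree_add_le_max)
  then show ?thesis
    by (simp add: poly_at_superset[of _ ?N] cst_add act_add_right sum.distrib)
qed

lemmas poly_at_zero [simp] = additive_zero[where T="poly_at p" for p, OF poly_at_add]
lemmas poly_at_minus = additive_minus[where T="poly_at p" for p, OF poly_at_add]
lemmas poly_at_sum = additive_sum[where T="poly_at p" for p, OF poly_at_add]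

lemma poly_at_pCons: "poly_at p (pCons 0 P) = p \<bullet> poly_at p P"
proof -
  have "poly_at p (pCons 0 P) = (\<Sum>j\<le>Suc (degree P). p ^ j \<bullet> cst (coeff (pCons 0 P) j))"
    by (rule poly_at_superset) (simp add: degree_pCons_eq_if)
  also have "\<dots> = p \<bullet> poly_at p P"
    by (simp add: sum.atMost_Suc_shift poly_at_def act_sum_right act_mult del: sum.atMost_Suc)
  finally show ?thesis .
qed

lemma poly_at_map_poly:
  assumes "complex_linear L"
  shows "poly_at p (map_poly L P) = Poly_Mapping.map L (poly_at p P)"
proof -
  have "Poly_Mapping.map L (poly_at p P) = (\<Sum>j\<le>degree P. Poly_Mapping.map L (p ^ j \<bullet> cst (coeff P j)))"
    unfolding poly_at_def by (rule additive_sum) (rule mpoly_map_add[OF assms])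
  then show ?thesis
    by (simp add: poly_at_superset[OF map_poly_degree_leq] mpoly_map_act assms mpoly_map_cst coeff_map_poly complex_linear_zero)
qed

lemma msubst_poly_at: "msubst \<sigma> (poly_at p P) = poly_at (msubst \<sigma> p) P"
  by (simp add: poly_at_def msubst_sum msubst_act msubst_power)

section \<open>Brackets with polynomial arguments\<close>

lemma conformal_add_left: "conformal_algebra UNIV m \<Longrightarrow> m (a + a') b = m a b + m a' b"
  and conformal_add_right: "conformal_algebra UNIV m \<Longrightarrow> m a (b + b') = m a b + m a b'"
  and conformal_scaleC_left: "conformal_algebra UNIV m \<Longrightarrow> m (c *\<^sub>C a) b = map_poly ((*\<^sub>C) c) (m a b)"
  and conformal_scaleC_right: "conformal_algebra UNIV m \<Longrightarrow> m a (c *\<^sub>C b) = map_poly ((*\<^sub>C) c) (m a b)"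
  and conformal_del_left: "conformal_algebra UNIV m \<Longrightarrow> m (\<partial> a) b = - pCons 0 (m a b)"
  and conformal_del_right: "conformal_algebra UNIV m \<Longrightarrow> m a (\<partial> b) = map_poly \<partial> (m a b) + pCons 0 (m a b)"
  by (simp_all add: conformal_algebra_def)

lemma conformal_zero_left: "conformal_algebra UNIV m \<Longrightarrow> m 0 b = 0"
  and conformal_zero_right: "conformal_algebra UNIV m \<Longrightarrow> m a 0 = 0"
  by (rule additive_zero, rule conformal_add_left, assumption)
     (rule additive_zero, rule conformal_add_right, assumption)

lemma lbr_add_left:
  assumes "conformal_algebra UNIV m"
  shows "lbr m p (F + F') G = lbr m p F G + lbr m p F' G"
  unfolding lbr_def
  by (rule sum_keys_add[where f = "\<lambda>u x. \<Sum>v\<in>Poly_Mapping.keys G.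
        Poly_Mapping.single (u + v) 1 \<bullet> poly_at p (m x (Poly_Mapping.lookup G v))"])
    (simp_all add: conformal_add_left[OF assms] conformal_zero_left[OF assms] poly_at_add act_add_right sum.distrib)

lemma lbr_add_right:
  assumes "conformal_algebra UNIV m"
  shows "lbr m p F (G + G') = lbr m p F G + lbr m p F G'"
  unfolding lbr_def sum.distrib[symmetric]
  by (rule sum.cong[OF refl], rule sum_keys_add[where f = "\<lambda>v x.
        Poly_Mapping.single (_ + v) 1 \<bullet> poly_at p (m (Poly_Mapping.lookup F _) x)"])
    (simp_all add: conformal_add_right[OF assms] conformal_zero_right[OF assms] poly_at_add act_add_right)

lemma lbr_zero_left [simp]: "lbr m p 0 G = 0"
  and lbr_zero_right [simp]: "lbr m p F 0 = 0"
  by (simp_all add: lbr_def)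

lemma lbr_single:
  assumes "conformal_algebra UNIV m"
  shows "lbr m p (Poly_Mapping.single u a) (Poly_Mapping.single v b) =
    Poly_Mapping.single (u + v) 1 \<bullet> poly_at p (m a b)"
  by (simp add: lbr_def conformal_zero_left[OF assms] conformal_zero_right[OF assms])

lemma lbr_cst:
  assumes "conformal_algebra UNIV m"
  shows "lbr m p (cst a) (cst b) = poly_at p (m a b)"
  by (simp add: cst_def lbr_single[OF assms])

lemma poly_at_scaleC: "poly_at p (map_poly ((*\<^sub>C) c) P) = Poly_Mapping.single 0 c \<bullet> poly_at p P"
  by (simp add: poly_at_map_poly complex_linear_scaleC_fun mpoly_map_scaleC)

lemma lbr_act_left:
  assumes "conformal_algebra UNIV m"
  shows "lbr m p (q \<bullet> F) G = q \<bullet> lbr m p F G"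
proof (induction q rule: mpoly_induct)
  case (single w c)
  show ?case
  proof (induction F rule: mpoly_induct)
    case (single u a)
    show ?case
      by (induction G rule: mpoly_induct)
        (simp_all add: act_single_single lbr_single[OF assms] conformal_scaleC_left[OF assms]
          poly_at_scaleC act_mult[symmetric] mult_single lbr_add_right[OF assms] act_add_right add.assoc)
  qed (simp_all add: lbr_add_left[OF assms] act_add_right)
qed (simp_all add: lbr_add_left[OF assms] act_add_left)

lemma lbr_act_right:
  assumes "conformal_algebra UNIV m"
  shows "lbr m p F (q \<bullet> G) = q \<bullet> lbr m p F G"
proof (induction q rule: mpoly_induct)
  case (single w c)
  show ?case
  proof (induction F rule: mpoly_induct)
    case (single u a)
    show ?case
      by (induction G rule: mpoly_induct)
        (simp_all add: act_single_single lbr_single[OF assms] conformal_scaleC_right[OF assms]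
          poly_at_scaleC act_mult[symmetric] mult_single lbr_add_right[OF assms] act_add_right add_ac)
  qed (simp_all add: lbr_add_left[OF assms] act_add_right)
qed (simp_all add: lbr_add_right[OF assms] act_add_left)

lemma lbr_diff_left: "conformal_algebra UNIV m \<Longrightarrow> lbr m p (F - F') G = lbr m p F G - lbr m p F' G"
  and lbr_diff_right: "conformal_algebra UNIV m \<Longrightarrow> lbr m p F (G - G') = lbr m p F G - lbr m p F G'"
  and lbr_sum_left: "conformal_algebra UNIV m \<Longrightarrow> lbr m p (sum f S) G = (\<Sum>i\<in>S. lbr m p (f i) G)"
  and lbr_sum_right: "conformal_algebra UNIV m \<Longrightarrow> lbr m p F (sum f S) = (\<Sum>i\<in>S. lbr m p F (f i))"
  using additive_diff[of "\<lambda>F. lbr m p F G"] additive_diff[of "lbr m p F"]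
    additive_sum[of "\<lambda>F. lbr m p F G"] additive_sum[of "lbr m p F"]
  by (simp_all add: lbr_add_left lbr_add_right)

text \<open>Linearity over $\mathbf{C}[\lambda_0,\lambda_1,\dots]$. Nested brackets are of this kind in each
  slot. Such a map is determined by its values on constants, which is used twice: to pass from an
  identity on elements of the algebra to one on polynomial arguments, and to insert a product
  coefficient by coefficient, as the differential does.\<close>

definition scalar_linear :: "('v::del_module mpoly \<Rightarrow> 'w::del_module mpoly) \<Rightarrow> bool" where
  "scalar_linear T \<longleftrightarrow> (\<forall>F G. T (F + G) = T F + T G) \<and> (\<forall>q F. T (q \<bullet> F) = q \<bullet> T F)"

lemma scalar_linear_add: "scalar_linear T \<Longrightarrow> T (F + G) = T F + T G"
  and scalar_linear_act: "scalar_linear T \<Longrightarrow> T (q \<bullet> F) = q \<bullet> T F"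
  by (simp_all add: scalar_linear_def)

lemma scalar_linear_zero: "scalar_linear T \<Longrightarrow> T 0 = 0"
  by (rule additive_zero) (rule scalar_linear_add)

lemma scalar_linear_sum_apply: "scalar_linear T \<Longrightarrow> T (sum f S) = (\<Sum>i\<in>S. T (f i))"
  by (rule additive_sum) (rule scalar_linear_add)

lemma scalar_linear_minus: "scalar_linear T \<Longrightarrow> T (- F) = - T F"
  by (rule additive_minus) (rule scalar_linear_add)

lemma scalar_linear_ident: "scalar_linear (\<lambda>X. X)"
  by (simp add: scalar_linear_def)

lemma scalar_linear_diff: "scalar_linear S \<Longrightarrow> scalar_linear T \<Longrightarrow> scalar_linear (\<lambda>X. S X - T X)"
  by (simp add: scalar_linear_def act_diff_right)

lemma scalar_linear_sum: "(\<And>i. i \<in> I \<Longrightarrow> scalar_linear (T i)) \<Longrightarrow> scalar_linear (\<lambda>X. \<Sum>i\<in>I. T i X)"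
  by (simp add: scalar_linear_def act_sum_right sum.distrib)

lemma scalar_linear_lbr_left:
  "conformal_algebra UNIV m \<Longrightarrow> scalar_linear T \<Longrightarrow> scalar_linear (\<lambda>X. lbr m p (T X) G)"
  by (simp add: scalar_linear_def lbr_add_left lbr_act_left)

lemma scalar_linear_lbr_right:
  "conformal_algebra UNIV m \<Longrightarrow> scalar_linear T \<Longrightarrow> scalar_linear (\<lambda>X. lbr m p F (T X))"
  by (simp add: scalar_linear_def lbr_add_right lbr_act_right)

lemmas scalar_linear_intros = scalar_linear_ident scalar_linear_lbr_left scalar_linear_lbr_right

lemma scalar_linear_eq_zero:
  assumes "scalar_linear T" "\<And>a. T (cst a) = 0"
  shows "T F = 0"
proof (induction F rule: mpoly_induct)
  case (single u a)
  then show ?case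
    by (subst single_eq_act_cst) (simp add: scalar_linear_act assms)
qed (simp_all add: scalar_linear_zero scalar_linear_add assms)

lemma scalar_linear_poly_at:
  assumes "scalar_linear T"
  shows "T (poly_at q P) = (\<Sum>l\<le>degree P. q ^ l \<bullet> T (cst (coeff P l)))"
  by (simp add: poly_at_def scalar_linear_sum_apply scalar_linear_act assms)

text \<open>This is how the shifted variables in the summands of the differential reach the bracket
  parameters.\<close>

lemma msubst_lbr:
  assumes m: "conformal_algebra UNIV m"
  shows "msubst \<sigma> (lbr m p F G) = lbr m (msubst \<sigma> p) (msubst \<sigma> F) (msubst \<sigma> G)"
proof (induction F rule: mpoly_induct)
  case (single u a)
  show ?case
  proof (induction G rule: mpoly_induct)
    case (single v b)
    show ?case
      by (subst (1 2) single_eq_act_cst, subst (3 4) single_eq_act_cst)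
        (simp add: lbr_act_left[OF m] lbr_act_right[OF m] msubst_act lbr_cst[OF m] msubst_poly_at)
  qed (simp_all add: lbr_add_right[OF m] msubst_add)
qed (simp_all add: lbr_add_left[OF m] msubst_add)

lemma mpoly_del_add: "mpoly_del (F + G) = mpoly_del F + mpoly_del G"
  by (simp add: mpoly_del_def mpoly_map_add complex_linear_del)

lemma mpoly_del_sum: "mpoly_del (sum f S) = (\<Sum>i\<in>S. mpoly_del (f i))"
  by (rule additive_sum) (rule mpoly_del_add)

lemma mpoly_del_diff: "mpoly_del (F - G) = mpoly_del F - mpoly_del G"
  by (rule additive_diff) (rule mpoly_del_add)

lemma mpoly_del_zero [simp]: "mpoly_del 0 = 0"
  by (simp add: mpoly_del_def)

lemma mpoly_del_cst: "mpoly_del (cst a) = cst (\<partial> a)"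
  by (simp add: mpoly_del_def mpoly_map_cst complex_linear_del)

lemma mpoly_del_act: "mpoly_del (p \<bullet> F) = p \<bullet> mpoly_del F"
  by (simp add: mpoly_del_def mpoly_map_act complex_linear_del)

lemma mpoly_del_single: "mpoly_del (Poly_Mapping.single u a) = Poly_Mapping.single u (\<partial> a)"
  by (subst (1 2) single_eq_act_cst) (simp only: mpoly_del_act mpoly_del_cst)

lemma poly_at_del: "poly_at p (map_poly \<partial> P) = mpoly_del (poly_at p P)"
  by (simp add: mpoly_del_def poly_at_map_poly complex_linear_del)

text \<open>Sesquilinearity, in the form that survives nesting: the derivation of an inner bracket is again
  expressed by \<^const>\<open>mpoly_del\<close>.\<close>

lemma lbr_del_left:
  assumes m: "conformal_algebra UNIV m"
  shows "lbr m p (mpoly_del F) G = - (p \<bullet> lbr m p F G)"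
proof (induction F rule: mpoly_induct)
  case (single u a)
  show ?case
    by (induction G rule: mpoly_induct)
      (simp_all add: mpoly_del_single lbr_single[OF m] conformal_del_left[OF m] poly_at_minus
        poly_at_pCons act_minus_right act_commute[of p] lbr_add_right[OF m] act_add_right)
qed (simp_all add: lbr_add_left[OF m] mpoly_del_add act_add_right)

lemma lbr_del_right:
  assumes m: "conformal_algebra UNIV m"
  shows "lbr m p F (mpoly_del G) = mpoly_del (lbr m p F G) + p \<bullet> lbr m p F G"
proof (induction F rule: mpoly_induct)
  case (single u a)
  show ?case
    by (induction G rule: mpoly_induct)
      (simp_all add: mpoly_del_single lbr_single[OF m] conformal_del_right[OF m] poly_at_add poly_at_del
        poly_at_pCons mpoly_del_act act_commute[of p] lbr_add_right[OF m] act_add_right mpoly_del_add)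
qed (simp_all add: lbr_add_left[OF m] mpoly_del_add act_add_right)

definition variables_below :: "nat \<Rightarrow> 'v::zero mpoly \<Rightarrow> bool" where
  "variables_below N F \<longleftrightarrow> (\<forall>u\<in>Poly_Mapping.keys F. Poly_Mapping.keys u \<subseteq> {..<N})"

lemma variables_below_add: "variables_below N F \<Longrightarrow> variables_below N G \<Longrightarrow> variables_below N (F + G)"
  for F :: "'v::monoid_add mpoly"
  unfolding variables_below_def using keys_add[of F G] by blast

lemma variables_below_minus: "variables_below N F \<Longrightarrow> variables_below N (- F)"
  for F :: "'v::ab_group_add mpoly"
  by (simp add: variables_below_def)

lemma variables_below_zero [simp]: "variables_below N 0"
  by (simp add: variables_below_def)

lemma variables_below_diff: "variables_below N F \<Longrightarrow> variables_below N G \<Longrightarrow> variables_below N (F - G)"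
  for F :: "'v::ab_group_add mpoly"
  using variables_below_add[of N F "- G"] by (simp add: variables_below_minus)

lemma variables_below_sum: "(\<And>i. i \<in> S \<Longrightarrow> variables_below N (f i)) \<Longrightarrow> variables_below N (sum f S)"
  for f :: "_ \<Rightarrow> 'v::ab_group_add mpoly"
  by (induction S rule: infinite_finite_induct) (auto intro: variables_below_add)

lemma variables_below_single: "Poly_Mapping.keys u \<subseteq> {..<N} \<Longrightarrow> variables_below N (Poly_Mapping.single u a)"
  by (simp add: variables_below_def)

lemma variables_below_cst: "variables_below N (cst a)"
  by (simp add: cst_def variables_below_single)

lemma variables_below_act:
  assumes "variables_below N p" "variables_below N F"
  shows "variables_below N (p \<bullet> F)"
  unfolding act_def
proof (intro variables_below_sum variables_below_single)
  fix u v assume "u \<in> Poly_Mapping.keys p" "v \<in> Poly_Mapping.keys F"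
  then show "Poly_Mapping.keys (u + v) \<subseteq> {..<N}"
    using assms keys_add[of u v] unfolding variables_below_def by blast
qed

lemma variables_below_lam: "i < N \<Longrightarrow> variables_below N (lam i)"
  by (simp add: variables_below_def lam_def)

lemma variables_below_poly_at:
  assumes "variables_below N p" shows "variables_below N (poly_at p P)"
proof -
  have "variables_below N (p ^ j)" for j
    using assms by (induction j)
      (simp_all add: act_scalar[symmetric] variables_below_act,
       simp add: single_one[symmetric] variables_below_single del: single_one)
  then show ?thesis
    unfolding poly_at_def by (intro variables_below_sum variables_below_act variables_below_cst)
qed

lemma variables_below_lbr:
  assumes "variables_below N p" "variables_below N F" "variables_below N G"
  shows "variables_below N (lbr m p F G)"
  unfolding lbr_def
proof (intro variables_below_sum variables_below_act variables_below_single variables_below_poly_at assms(1))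
  fix u v assume "u \<in> Poly_Mapping.keys F" "v \<in> Poly_Mapping.keys G"
  then show "Poly_Mapping.keys (u + v) \<subseteq> {..<N}"
    using assms keys_add[of u v] unfolding variables_below_def by blast
qed

section \<open>Associators and the pentagon identity\<close>

text \<open>For the product $\sum_k \hbar^k \mu_k$ this is the coefficient of $\hbar^N$ in
  $(F G) H - F (G H)$. The parameters and arguments are arbitrary polynomials, since the pentagon
  identity feeds brackets into the associator.\<close>

definition associator ::
    "(nat \<Rightarrow> 'a::del_module \<Rightarrow> 'a \<Rightarrow> 'a poly) \<Rightarrow> nat \<Rightarrow> scalar_mpoly \<Rightarrow> scalar_mpoly
     \<Rightarrow> 'a mpoly \<Rightarrow> 'a mpoly \<Rightarrow> 'a mpoly \<Rightarrow> 'a mpoly" where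
  "associator \<mu> N p q F G H = (\<Sum>(r, s)\<in>{(r, s). r + s = N}.
     lbr (\<mu> r) (p + q) (lbr (\<mu> s) p F G) H - lbr (\<mu> r) p F (lbr (\<mu> s) q G H))"

lemma finite_pairs [simp]: "finite {(r, s). r + s = (N::nat)}"
  by (rule finite_subset[of _ "{..N} \<times> {..N}"]) auto

lemma finite_triples [simp]: "finite {(x, y, z). x + y + z = (N::nat)}"
  by (rule finite_subset[of _ "{..N} \<times> {..N} \<times> {..N}"]) auto

definition triple_sum :: "nat \<Rightarrow> (nat \<Rightarrow> nat \<Rightarrow> nat \<Rightarrow> 'v) \<Rightarrow> 'v::comm_monoid_add" where
  "triple_sum N t = (\<Sum>(x, y, z)\<in>{(x, y, z). x + y + z = N}. t x y z)"

lemma nested_sum_eq_triple_sum: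
  "(\<Sum>(q, j)\<in>{(q, j). q + j = N}. \<Sum>(r, s)\<in>{(r, s). r + s = j}. t q r s) = triple_sum N t"
proof -
  have "(\<Sum>(q, j)\<in>{(q, j). q + j = N}. \<Sum>(r, s)\<in>{(r, s). r + s = j}. t q r s)
      = (\<Sum>x\<in>{(q, j). q + j = N}. \<Sum>y\<in>{(r, s). r + s = snd x}. t (fst x) (fst y) (snd y))"
    by (simp add: split_def)
  also have "\<dots> = (\<Sum>(x, y)\<in>(SIGMA x:{(q, j). q + j = N}. {(r, s). r + s = snd x}). t (fst x) (fst y) (snd y))"
    by (rule sum.Sigma) auto
  also have "\<dots> = triple_sum N t"
    unfolding triple_sum_def
    by (rule sum.reindex_bij_witness[where i = "\<lambda>(q, r, s). ((q, r + s), (r, s))"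
          and j = "\<lambda>((q, j), (r, s)). (q, r, s)"]) auto
  finally show ?thesis .
qed

lemma triple_sum_rotate: "triple_sum N (\<lambda>x y z. t y z x) = triple_sum N t"
  unfolding triple_sum_def
  by (rule sum.reindex_bij_witness[where i = "\<lambda>(y, z, x). (x, y, z)" and j = "\<lambda>(x, y, z). (y, z, x)"]) auto

lemma triple_sum_swap: "triple_sum N (\<lambda>x y z. t y x z) = triple_sum N t"
  unfolding triple_sum_def
  by (rule sum.reindex_bij_witness[where i = "\<lambda>(y, x, z). (x, y, z)" and j = "\<lambda>(x, y, z). (y, x, z)"]) auto

lemma triple_sum_diff:
  fixes t :: "nat \<Rightarrow> nat \<Rightarrow> nat \<Rightarrow> 'v::ab_group_add"
  shows "triple_sum N (\<lambda>x y z. t x y z - t' x y z) = triple_sum N t - triple_sum N t'"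
  by (simp add: triple_sum_def split_def sum_subtractf)

text \<open>The inner sum of a middle summand of the differential, read as the insertion of a whole bracket
  into one slot.\<close>

lemma dH_insert_product:
  assumes "scalar_linear T" "conformal_algebra UNIV m"
  shows "(let P = m a b in \<Sum>l\<le>degree P. q ^ l \<bullet> T (cst (coeff P l))) = T (lbr m q (cst a) (cst b))"
  using assms by (simp add: Let_def lbr_cst scalar_linear_poly_at)

context
  fixes \<mu> :: "nat \<Rightarrow> 'a::del_module \<Rightarrow> 'a \<Rightarrow> 'a poly"
  assumes conf: "\<And>r. conformal_algebra UNIV (\<mu> r)"
begin

lemma scalar_linear_associator:
  shows "scalar_linear (\<lambda>X. associator \<mu> N p q X G H)"
    and "scalar_linear (\<lambda>X. associator \<mu> N p q F X H)"
    and "scalar_linear (\<lambda>X. associator \<mu> N p q F G X)"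
  unfolding associator_def split_def
  by (intro scalar_linear_sum scalar_linear_diff scalar_linear_intros conf)+

lemma msubst_associator:
  "msubst \<sigma> (associator \<mu> N p q F G H) =
    associator \<mu> N (msubst \<sigma> p) (msubst \<sigma> q) (msubst \<sigma> F) (msubst \<sigma> G) (msubst \<sigma> H)"
  by (simp add: associator_def msubst_sum split_def msubst_diff msubst_lbr[OF conf] msubst_add)

text \<open>Substitution turns the variables into arbitrary parameters, and linearity over the scalar
  polynomials extends the three arguments one at a time.\<close>

lemma associator_eq_zero:
  assumes "\<And>a b c. associator \<mu> N (lam 0) (lam 1) (cst a) (cst b) (cst c) = 0"
  shows "associator \<mu> N p q F G H = 0"
proof -
  have "associator \<mu> N p q (cst a) (cst b) (cst c) = 0" for a b c
    using arg_cong[OF assms[of a b c], of "msubst (\<lambda>i. if i = 0 then p else q)"]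
    by (simp add: msubst_associator)
  then have "associator \<mu> N p q F (cst b) (cst c) = 0" for b c
    using scalar_linear_eq_zero[OF scalar_linear_associator(1)] by blast
  then have "associator \<mu> N p q F G (cst c) = 0" for c
    using scalar_linear_eq_zero[OF scalar_linear_associator(2)] by blast
  then show ?thesis
    using scalar_linear_eq_zero[OF scalar_linear_associator(3)] by blast
qed

text \<open>The coefficient of $\hbar^N$ of the identity
  $a\,(b,c,d) - (ab,c,d) + (a,bc,d) - (a,b,cd) + (a,b,c)\,d = 0$, which holds for the associator
  $(x,y,z) = (xy)z - x(yz)$ of any bilinear product. Each of the five ways to bracket four factors
  occurs twice, with opposite signs; the two occurrences number the brackets in different orders,
  which does not matter because the sum runs over all triples of indices.\<close>

lemma pentagon:
  "(\<Sum>(q, j)\<in>{(q, j). q + j = N}.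
      lbr (\<mu> q) p1 F1 (associator \<mu> j p2 p3 F2 F3 F4)
    - associator \<mu> j (p1 + p2) p3 (lbr (\<mu> q) p1 F1 F2) F3 F4
    + associator \<mu> j p1 (p2 + p3) F1 (lbr (\<mu> q) p2 F2 F3) F4
    - associator \<mu> j p1 p2 F1 F2 (lbr (\<mu> q) p3 F3 F4)
    + lbr (\<mu> q) (p1 + p2 + p3) (associator \<mu> j p1 p2 F1 F2 F3) F4) = 0"
proof -
  \<comment> \<open>one family for each bracketing of four factors\<close>
  define W1 where "W1 x y z = lbr (\<mu> x) p1 F1 (lbr (\<mu> y) (p2 + p3) (lbr (\<mu> z) p2 F2 F3) F4)" for x y z
  define W2 where "W2 x y z = lbr (\<mu> x) p1 F1 (lbr (\<mu> y) p2 F2 (lbr (\<mu> z) p3 F3 F4))" for x y z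
  define W3 where "W3 x y z = lbr (\<mu> x) (p1 + p2 + p3) (lbr (\<mu> y) (p1 + p2) (lbr (\<mu> z) p1 F1 F2) F3) F4" for x y z
  define W4 where "W4 x y z = lbr (\<mu> x) (p1 + p2) (lbr (\<mu> y) p1 F1 F2) (lbr (\<mu> z) p3 F3 F4)" for x y z
  define W5 where "W5 x y z = lbr (\<mu> x) (p1 + p2 + p3) (lbr (\<mu> y) p1 F1 (lbr (\<mu> z) p2 F2 F3)) F4" for x y z
  note lin = lbr_sum_left[OF conf] lbr_sum_right[OF conf] lbr_diff_left[OF conf] lbr_diff_right[OF conf]
    sum_subtractf
  have 1: "(\<Sum>(q, j)\<in>{(q, j). q + j = N}. lbr (\<mu> q) p1 F1 (associator \<mu> j p2 p3 F2 F3 F4))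
      = triple_sum N W1 - triple_sum N W2"
    unfolding triple_sum_diff[symmetric] nested_sum_eq_triple_sum[symmetric]
    by (simp add: associator_def split_def lin W1_def W2_def)
  have 2: "(\<Sum>(q, j)\<in>{(q, j). q + j = N}. associator \<mu> j (p1 + p2) p3 (lbr (\<mu> q) p1 F1 F2) F3 F4)
      = triple_sum N (\<lambda>q r s. W3 r s q) - triple_sum N (\<lambda>q r s. W4 r q s)"
    unfolding triple_sum_diff[symmetric] nested_sum_eq_triple_sum[symmetric]
    by (simp add: associator_def split_def sum_subtractf W3_def W4_def)
  have 3: "(\<Sum>(q, j)\<in>{(q, j). q + j = N}. associator \<mu> j p1 (p2 + p3) F1 (lbr (\<mu> q) p2 F2 F3) F4)
      = triple_sum N (\<lambda>q r s. W5 r s q) - triple_sum N (\<lambda>q r s. W1 r s q)"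
    unfolding triple_sum_diff[symmetric] nested_sum_eq_triple_sum[symmetric]
    by (simp add: associator_def split_def sum_subtractf W5_def W1_def add.assoc)
  have 4: "(\<Sum>(q, j)\<in>{(q, j). q + j = N}. associator \<mu> j p1 p2 F1 F2 (lbr (\<mu> q) p3 F3 F4))
      = triple_sum N (\<lambda>q r s. W4 r s q) - triple_sum N (\<lambda>q r s. W2 r s q)"
    unfolding triple_sum_diff[symmetric] nested_sum_eq_triple_sum[symmetric]
    by (simp add: associator_def split_def sum_subtractf W4_def W2_def)
  have 5: "(\<Sum>(q, j)\<in>{(q, j). q + j = N}. lbr (\<mu> q) (p1 + p2 + p3) (associator \<mu> j p1 p2 F1 F2 F3) F4)
      = triple_sum N W3 - triple_sum N W5"
    unfolding triple_sum_diff[symmetric] nested_sum_eq_triple_sum[symmetric]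
    by (simp add: associator_def split_def lin W3_def W5_def)
  show ?thesis
    using 1 2 3 4 5
      triple_sum_rotate[of N W1] triple_sum_rotate[of N W2] triple_sum_rotate[of N W3]
      triple_sum_rotate[of N W4] triple_sum_rotate[of N W5] triple_sum_swap[of N W4]
    by (simp add: split_def sum.distrib sum_subtractf)
qed

text \<open>The differential of the associator in order \<open>N\<close> is the part of the pentagon identity of order \<open>N\<close>
  in which \<open>\<mu> 0\<close> is the bracket outside the associator. In every other part the associator has a lower
  order, and vanishes by hypothesis.\<close>

lemma dH_associator:
  assumes \<gamma>: "\<And>a b c. \<gamma> [a, b, c] = associator \<mu> N (lam 0) (lam 1) (cst a) (cst b) (cst c)"
    and m: "m = \<mu> 0"
    and van: "\<And>j a b c. j < N \<Longrightarrow> associator \<mu> j (lam 0) (lam 1) (cst a) (cst b) (cst c) = 0"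
  shows "dH m 3 \<gamma> [a, b, c, d] = 0"
proof -
  define E where "E q j = lbr (\<mu> q) (lam 0) (cst a) (associator \<mu> j (lam 1) (lam 2) (cst b) (cst c) (cst d))
    - associator \<mu> j (lam 0 + lam 1) (lam 2) (lbr (\<mu> q) (lam 0) (cst a) (cst b)) (cst c) (cst d)
    + associator \<mu> j (lam 0) (lam 1 + lam 2) (cst a) (lbr (\<mu> q) (lam 1) (cst b) (cst c)) (cst d)
    - associator \<mu> j (lam 0) (lam 1) (cst a) (cst b) (lbr (\<mu> q) (lam 2) (cst c) (cst d))
    + lbr (\<mu> q) (lam 0 + lam 1 + lam 2) (associator \<mu> j (lam 0) (lam 1) (cst a) (cst b) (cst c)) (cst d)" for q j
  have small: "E q j = 0" if "j < N" for q j
    using associator_eq_zero[OF van[OF that]] by (simp add: E_def)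
  have "(\<Sum>(q, j)\<in>{(q, j). q + j = N}. E q j) = (\<Sum>(q, j)\<in>{(0, N)}. E q j)"
  proof (rule sum.mono_neutral_right)
    show "\<forall>x\<in>{(q, j). q + j = N} - {(0, N)}. (case x of (q, j) \<Rightarrow> E q j) = 0"
    proof
      fix x assume "x \<in> {(q, j). q + j = N} - {(0, N)}"
      then obtain q j where "x = (q, j)" "j < N"
        by (cases x) auto
      then show "(case x of (q, j) \<Rightarrow> E q j) = 0"
        by (simp add: small)
    qed
  qed auto
  then have "E 0 N = 0"
    using pentagon[where N = N and ?p1.0 = "lam 0" and ?p2.0 = "lam 1" and ?p3.0 = "lam 2"
        and ?F1.0 = "cst a" and ?F2.0 = "cst b" and ?F3.0 = "cst c" and ?F4.0 = "cst d"]
    by (simp add: E_def)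
  moreover have "dH m 3 \<gamma> [a, b, c, d] = E 0 N"
    by (simp add: dH_def numeral_3_eq_3 \<gamma> msubst_associator msubst_add m
        dH_insert_product[OF scalar_linear_associator(1) conf]
        dH_insert_product[OF scalar_linear_associator(2) conf]
        dH_insert_product[OF scalar_linear_associator(3) conf]
        act_minus_left E_def numeral_2_eq_2)
  ultimately show ?thesis by simp
qed

end

section \<open>The obstruction cochain\<close>

lemma conformal_zero_bracket: "conformal_algebra UNIV (\<lambda>_ _. 0)"
  by (simp add: conformal_algebra_def submodule_def)

definition bracket_cochain :: "('a \<Rightarrow> 'a \<Rightarrow> 'a poly) \<Rightarrow> 'a::del_module list \<Rightarrow> 'a mpoly" where
  "bracket_cochain \<nu> as = (case as of [a, b] \<Rightarrow> lbr \<nu> (lam 0) (cst a) (cst b) | _ \<Rightarrow> 0)"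

lemma dH_bracket_cochain:
  assumes m: "conformal_algebra UNIV m" and \<nu>: "conformal_algebra UNIV \<nu>"
  shows "dH m 2 (bracket_cochain \<nu>) [a, b, c] =
      lbr m (lam 0) (cst a) (lbr \<nu> (lam 1) (cst b) (cst c))
    - lbr \<nu> (lam 0 + lam 1) (lbr m (lam 0) (cst a) (cst b)) (cst c)
    + lbr \<nu> (lam 0) (cst a) (lbr m (lam 1) (cst b) (cst c))
    - lbr m (lam 0 + lam 1) (lbr \<nu> (lam 0) (cst a) (cst b)) (cst c)"
  by (simp add: dH_def numeral_2_eq_2 bracket_cochain_def msubst_lbr[OF \<nu>] act_minus_left
      dH_insert_product[OF scalar_linear_lbr_left[OF \<nu> scalar_linear_ident] m]
      dH_insert_product[OF scalar_linear_lbr_right[OF \<nu> scalar_linear_ident] m])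

lemma pairs_Suc_split:
  "{(r, s). r + s = Suc n} = {(0, Suc n), (Suc n, 0)} \<union> {(r, s). r + s = n + 1 \<and> r \<ge> 1 \<and> s \<ge> 1}"
  by (auto intro: Suc_leI)

text \<open>In the associator of order \<open>n + 1\<close>, the bracket \<open>\<mu> (Suc n)\<close> can meet only \<open>\<mu> 0\<close>, and these four
  terms form a Hochschild differential. What remains involves only the brackets of orders between
  \<open>1\<close> and \<open>n\<close>.\<close>

lemma associator_eq_theta_minus_dH:
  assumes "\<And>r. conformal_algebra UNIV (\<mu> r)"
  shows "associator \<mu> (Suc n) (lam 0) (lam 1) (cst a) (cst b) (cst c) =
    theta n \<mu> [a, b, c] - dH (\<mu> 0) 2 (bracket_cochain (\<mu> (Suc n))) [a, b, c]"
proof -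
  have "finite {(r, s). r + s = n + 1 \<and> r \<ge> 1 \<and> s \<ge> 1}"
    by (rule finite_subset[OF _ finite_pairs[of "n + 1"]]) auto
  then show ?thesis
    unfolding associator_def pairs_Suc_split
    by (subst sum.union_disjoint) (auto simp: theta_def dH_bracket_cochain[OF assms assms])
qed

text \<open>The values of a deformation beyond its order are arbitrary. Setting them to \<open>0\<close> makes every
  bracket conformal, so that the pentagon identity applies, and removes the differential from
  the previous lemma.\<close>

definition truncate_brackets :: "nat \<Rightarrow> (nat \<Rightarrow> 'a \<Rightarrow> 'a \<Rightarrow> 'a poly) \<Rightarrow> nat \<Rightarrow> 'a \<Rightarrow> 'a \<Rightarrow> 'a::zero poly" where
  "truncate_brackets n \<mu> r = (if r \<le> n then \<mu> r else (\<lambda>_ _. 0))"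

lemma conformal_truncate_brackets:
  "(\<And>r. r \<le> n \<Longrightarrow> conformal_algebra UNIV (\<mu> r)) \<Longrightarrow> conformal_algebra UNIV (truncate_brackets n \<mu> r)"
  by (simp add: truncate_brackets_def conformal_zero_bracket)

lemma theta_eq_associator:
  assumes "\<And>r. r \<le> n \<Longrightarrow> conformal_algebra UNIV (\<mu> r)"
  shows "theta n \<mu> [a, b, c] = associator (truncate_brackets n \<mu>) (Suc n) (lam 0) (lam 1) (cst a) (cst b) (cst c)"
proof -
  let ?\<nu> = "truncate_brackets n \<mu>"
  have conf: "conformal_algebra UNIV (?\<nu> r)" for r
    by (rule conformal_truncate_brackets) (rule assms)
  have 1: "theta n \<mu> [a, b, c] = theta n ?\<nu> [a, b, c]"
    unfolding theta_def by (auto intro!: sum.cong simp: truncate_brackets_def)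
  have "dH (?\<nu> 0) 2 (bracket_cochain (?\<nu> (Suc n))) [a, b, c] = 0"
    by (simp add: dH_bracket_cochain[OF conf conf]) (simp add: truncate_brackets_def lbr_def)
  then show ?thesis
    unfolding 1 using associator_eq_theta_minus_dH[of ?\<nu> n a b c, OF conf] by simp
qed

lemma length_2E:
  assumes "length as = 2" obtains a b where "as = [a, b]"
  using assms by (auto simp: numeral_2_eq_2 length_Suc_conv)

lemma length_3E:
  assumes "length as = 3" obtains a b c where "as = [a, b, c]"
  using assms by (auto simp: numeral_3_eq_3 length_Suc_conv)

lemma length_4E:
  assumes "length as = 4" obtains a b c d where "as = [a, b, c, d]"
  using assms by (auto simp: eval_nat_numeral length_Suc_conv)

lemma bracket_cochain_in_cochains:
  assumes \<nu>: "conformal_algebra UNIV \<nu>"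
  shows "bracket_cochain \<nu> \<in> cochains 2"
proof -
  have "bracket_cochain \<nu> as = 0" if "length as \<noteq> 2" for as
    using that by (auto simp: bracket_cochain_def split: list.splits)
  moreover have keys: "x = 0" if "u \<in> Poly_Mapping.keys (lbr \<nu> (lam 0) (cst a) (cst b))"
      "x \<in> Poly_Mapping.keys u" for a b u x
    using variables_below_lbr[OF variables_below_lam[of 0 1] variables_below_cst variables_below_cst, of \<nu> a b]
      that unfolding variables_below_def by auto
  ultimately show ?thesis
    unfolding cochains_def
    by (auto simp: less_2_cases_iff bracket_cochain_def cst_add cst_scaleC mpoly_map_scaleC
        lbr_add_left[OF \<nu>] lbr_add_right[OF \<nu>] lbr_act_left[OF \<nu>] lbr_act_right[OF \<nu>]
        mpoly_del_cst[symmetric] lbr_del_left[OF \<nu>] lbr_del_right[OF \<nu>] act_minus_left add.commute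
        elim!: length_2E dest: keys)
qed

lemma scaleC_cochain_slot: "scalar_linear T \<Longrightarrow> T (cst (c *\<^sub>C x)) = Poly_Mapping.map ((*\<^sub>C) c) (T (cst x))"
  by (simp add: cst_scaleC mpoly_map_scaleC scalar_linear_act)

lemma associator_del_left:
  assumes "\<And>r. conformal_algebra UNIV (\<mu> r)"
  shows "associator \<mu> N p q (mpoly_del F) G H = - (p \<bullet> associator \<mu> N p q F G H)"
  by (simp add: associator_def lbr_del_left assms lbr_act_left scalar_linear_minus[OF scalar_linear_lbr_left[OF assms scalar_linear_ident]]
      act_sum_right act_diff_right split_def sum_negf[symmetric])

lemma associator_del_middle:
  assumes "\<And>r. conformal_algebra UNIV (\<mu> r)"
  shows "associator \<mu> N p q F (mpoly_del G) H = - (q \<bullet> associator \<mu> N p q F G H)"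
  by (simp add: associator_def lbr_del_left lbr_del_right assms lbr_act_left lbr_act_right lbr_add_left
      scalar_linear_minus[OF scalar_linear_lbr_right[OF assms scalar_linear_ident]]
      act_sum_right act_add_left act_diff_right split_def sum_negf[symmetric])

lemma associator_del_right:
  assumes "\<And>r. conformal_algebra UNIV (\<mu> r)"
  shows "associator \<mu> N p q F G (mpoly_del H) =
    (p + q) \<bullet> associator \<mu> N p q F G H + mpoly_del (associator \<mu> N p q F G H)"
proof -
  show ?thesis
    unfolding associator_def split_def mpoly_del_sum act_sum_right sum.distrib[symmetric]
    by (simp add: mpoly_del_diff lbr_del_right assms lbr_act_right lbr_add_right
      act_add_left act_diff_right algebra_simps)
qed

lemma theta_in_cochains:
  assumes "\<And>r. r \<le> n \<Longrightarrow> conformal_algebra UNIV (\<mu> r)"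
  shows "theta n \<mu> \<in> cochains 3"
proof -
  let ?\<nu> = "truncate_brackets n \<mu>"
  have conf: "conformal_algebra UNIV (?\<nu> r)" for r
    by (rule conformal_truncate_brackets) (rule assms)
  have theta: "theta n \<mu> [a, b, c] = associator ?\<nu> (Suc n) (lam 0) (lam 1) (cst a) (cst b) (cst c)" for a b c
    by (rule theta_eq_associator) (rule assms)
  note lin = scalar_linear_associator[of ?\<nu>, OF conf]
  have "theta n \<mu> as = 0" if "length as \<noteq> 3" for as
    using that by (auto simp: theta_def split: list.splits)
  moreover have keys: "x < 2" if "u \<in> Poly_Mapping.keys (theta n \<mu> [a, b, c])"
      "x \<in> Poly_Mapping.keys u" for a b c u x
  proof -
    have "variables_below 2 (theta n \<mu> [a, b, c])"
      unfolding theta associator_def split_def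
      by (intro variables_below_sum variables_below_diff variables_below_lbr variables_below_add
          variables_below_lam variables_below_cst) auto
    then show ?thesis
      using that unfolding variables_below_def by auto
  qed
  moreover have "i < 3 \<longleftrightarrow> i = 0 \<or> i = 1 \<or> i = (2::nat)" for i by auto
  moreover have "[a, b, c][2 := x] = [a, b, x]" for a b c x :: 'a
    by (simp add: numeral_2_eq_2)
  moreover have "sum lam {..<2} = lam 0 + lam 1"
    by (simp add: numeral_2_eq_2)
  ultimately show ?thesis
    unfolding cochains_def
    by (auto simp: less_2_cases_iff theta cst_add scalar_linear_add[OF lin(1)]
        scalar_linear_add[OF lin(2)] scalar_linear_add[OF lin(3)] scaleC_cochain_slot[OF lin(1)]
        scaleC_cochain_slot[OF lin(2)] scaleC_cochain_slot[OF lin(3)]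
        mpoly_del_cst[symmetric] associator_del_left[OF conf] associator_del_middle[OF conf]
        associator_del_right[OF conf] act_minus_left
        elim!: length_3E)
qed

section \<open>Deformations in terms of associators\<close>

lemma fps_nth_scaleC: "fps_nth (c *\<^sub>C f) i = c *\<^sub>C fps_nth f i"
  by (simp add: scaleC_fps_def)

lemma fps_nth_del: "fps_nth (\<partial> f) i = \<partial> (fps_nth f i)"
  by (simp add: del_fps_def)

abbreviation hbar_coeff :: "nat \<Rightarrow> 'a::del_module fps mpoly \<Rightarrow> 'a mpoly" where
  "hbar_coeff N \<equiv> Poly_Mapping.map (\<lambda>f. fps_nth f N)"

lemma hbar_coeff_lookup: "Poly_Mapping.lookup (hbar_coeff N F) u = fps_nth (Poly_Mapping.lookup F u) N"
  by (simp add: mpoly_map_lookup)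

lemma hbar_coeff_eqI: "(\<And>N. hbar_coeff N F = hbar_coeff N G) \<Longrightarrow> F = G"
  by (intro poly_mapping_eqI fps_ext) (metis hbar_coeff_lookup)

lemma hbar_coeff_add: "hbar_coeff N (F + G) = hbar_coeff N F + hbar_coeff N G"
  by (rule mpoly_map_add) (rule complex_linear_fps_nth)

lemma hbar_coeff_cst: "hbar_coeff N (cst f) = cst (fps_nth f N)"
  by (rule mpoly_map_cst) (rule complex_linear_fps_nth)

lemma hbar_op_nth:
  "fps_nth (coeff (hbar_op n \<mu> f g) l) N =
    (if N \<le> n then \<Sum>(i, j, k)\<in>{(i, j, k). i + j + k = N}. coeff (\<mu> k (fps_nth f i) (fps_nth g j)) l else 0)"
proof -
  have fin: "finite {(i, j, k). i + j + k \<le> n}"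
    by (rule finite_subset[of _ "{..n} \<times> {..n} \<times> {..n}"]) auto
  have "fps_nth (coeff (hbar_op n \<mu> f g) l) N = (\<Sum>(i, j, k)\<in>{(i, j, k). i + j + k \<le> n}.
      if N = i + j + k then coeff (\<mu> k (fps_nth f i) (fps_nth g j)) l else 0)"
    by (auto simp: hbar_op_def coeff_sum fps_sum_nth coeff_map_poly hbar_times_def fps_eq_iff intro!: sum.cong)
  also have "\<dots> = (if N \<le> n then \<Sum>(i, j, k)\<in>{(i, j, k). i + j + k = N}. coeff (\<mu> k (fps_nth f i) (fps_nth g j)) l else 0)"
  proof (cases "N \<le> n")
    case True
    then show ?thesis
      by (simp, intro sum.mono_neutral_cong_right fin) (auto split: if_splits)
  next
    case False
    then show ?thesis
      by (auto intro!: sum.neutral)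
  qed
  finally show ?thesis .
qed

lemma hbar_op_cong:
  assumes "\<And>r. r \<le> n \<Longrightarrow> \<mu> r = \<nu> r"
  shows "hbar_op n \<mu> = hbar_op n \<nu>"
  unfolding hbar_op_def by (intro ext sum.cong refl) (auto simp: assms)

lemma associator_cong:
  assumes "\<And>r. r \<le> N \<Longrightarrow> \<mu> r = \<nu> r"
  shows "associator \<mu> N = associator \<nu> N"
  unfolding associator_def by (intro ext sum.cong refl) (auto simp: assms)

lemma theta_cong:
  assumes "\<And>r. r \<le> n \<Longrightarrow> \<mu> r = \<nu> r"
  shows "theta n \<mu> = theta n \<nu>"
  unfolding theta_def by (intro ext list.case_cong refl sum.cong) (auto simp: assms)

lemma conformal_algebra_subset:
  assumes m: "conformal_algebra UNIV m"
    and "submodule V" "\<And>a b j. coeff (m a b) j \<in> V"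
  shows "conformal_algebra V m"
  using assms(2,3) unfolding conformal_algebra_def
  by (simp add: conformal_add_left[OF m] conformal_add_right[OF m] conformal_scaleC_left[OF m]
      conformal_scaleC_right[OF m] conformal_del_left[OF m] conformal_del_right[OF m])

lemma submodule_truncated: "submodule (truncated n)"
  by (simp add: submodule_def truncated_def scaleC_fps_def del_fps_def)

lemma finite_quadruples [simp]: "finite {(i, j, l, e). i + j + l + e = (N::nat)}"
  by (rule finite_subset[of _ "{..N} \<times> {..N} \<times> {..N} \<times> {..N}"]) auto

definition quintuple_sum ::
    "nat \<Rightarrow> (nat \<Rightarrow> nat \<Rightarrow> nat \<Rightarrow> nat \<Rightarrow> nat \<Rightarrow> 'v) \<Rightarrow> 'v::comm_monoid_add" where
  "quintuple_sum N t = (\<Sum>(i, j, l, r, s)\<in>{(i, j, l, r, s). i + j + l + r + s = N}. t i j l r s)"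

text \<open>Composing two $\hbar$-bilinear operations distributes the order in $\hbar$ over three arguments and
  two brackets. The next three lemmas bring the orders of summation for $F(GH)$, for $(FG)H$ and for
  the associators to one form.\<close>

lemma sum_split_right:
  "(\<Sum>(i, h, r)\<in>{(i, h, r). i + h + r = N}. \<Sum>(j, l, s)\<in>{(j, l, s). j + l + s = h}. t i j l r s) =
   quintuple_sum N t"
proof -
  have "(\<Sum>(i, h, r)\<in>{(i, h, r). i + h + r = N}. \<Sum>(j, l, s)\<in>{(j, l, s). j + l + s = h}. t i j l r s)
      = (\<Sum>x\<in>{(i, h, r). i + h + r = N}. \<Sum>y\<in>{(j, l, s). j + l + s = fst (snd x)}.
          t (fst x) (fst y) (fst (snd y)) (snd (snd x)) (snd (snd y)))"
    by (simp add: split_def)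
  also have "\<dots> = (\<Sum>(x, y)\<in>(SIGMA x:{(i, h, r). i + h + r = N}. {(j, l, s). j + l + s = fst (snd x)}).
      t (fst x) (fst y) (fst (snd y)) (snd (snd x)) (snd (snd y)))"
    by (rule sum.Sigma) auto
  also have "\<dots> = quintuple_sum N t"
    unfolding quintuple_sum_def
    by (rule sum.reindex_bij_witness[where i = "\<lambda>(i, j, l, r, s). ((i, j + l + s, r), (j, l, s))"
          and j = "\<lambda>((i, h, r), (j, l, s)). (i, j, l, r, s)"]) auto
  finally show ?thesis .
qed

lemma sum_split_left:
  "(\<Sum>(h, l, r)\<in>{(h, l, r). h + l + r = N}. \<Sum>(i, j, s)\<in>{(i, j, s). i + j + s = h}. t i j l r s) =
   quintuple_sum N t"
proof -
  have "(\<Sum>(h, l, r)\<in>{(h, l, r). h + l + r = N}. \<Sum>(i, j, s)\<in>{(i, j, s). i + j + s = h}. t i j l r s)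
      = (\<Sum>x\<in>{(h, l, r). h + l + r = N}. \<Sum>y\<in>{(i, j, s). i + j + s = fst x}.
          t (fst y) (fst (snd y)) (fst (snd x)) (snd (snd x)) (snd (snd y)))"
    by (simp add: split_def)
  also have "\<dots> = (\<Sum>(x, y)\<in>(SIGMA x:{(h, l, r). h + l + r = N}. {(i, j, s). i + j + s = fst x}).
      t (fst y) (fst (snd y)) (fst (snd x)) (snd (snd x)) (snd (snd y)))"
    by (rule sum.Sigma) auto
  also have "\<dots> = quintuple_sum N t"
    unfolding quintuple_sum_def
    by (rule sum.reindex_bij_witness[where i = "\<lambda>(i, j, l, r, s). ((i + j + s, l, r), (i, j, s))"
          and j = "\<lambda>((h, l, r), (i, j, s)). (i, j, l, r, s)"]) auto
  finally show ?thesis .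
qed

lemma sum_split_brackets:
  "(\<Sum>(i, j, l, e)\<in>{(i, j, l, e). i + j + l + e = N}. \<Sum>(r, s)\<in>{(r, s). r + s = e}. t i j l r s) =
   quintuple_sum N t"
proof -
  have "(\<Sum>(i, j, l, e)\<in>{(i, j, l, e). i + j + l + e = N}. \<Sum>(r, s)\<in>{(r, s). r + s = e}. t i j l r s)
      = (\<Sum>x\<in>{(i, j, l, e). i + j + l + e = N}. \<Sum>y\<in>{(r, s). r + s = snd (snd (snd x))}.
          t (fst x) (fst (snd x)) (fst (snd (snd x))) (fst y) (snd y))"
    by (simp add: split_def)
  also have "\<dots> = (\<Sum>(x, y)\<in>(SIGMA x:{(i, j, l, e). i + j + l + e = N}. {(r, s). r + s = snd (snd (snd x))}).
      t (fst x) (fst (snd x)) (fst (snd (snd x))) (fst y) (snd y))"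
    by (rule sum.Sigma) auto
  also have "\<dots> = quintuple_sum N t"
    unfolding quintuple_sum_def
    by (rule sum.reindex_bij_witness[where i = "\<lambda>(i, j, l, r, s). ((i, j, l, r + s), (r, s))"
          and j = "\<lambda>((i, j, l, e), (r, s)). (i, j, l, r, s)"]) auto
  finally show ?thesis .
qed

context
  fixes \<mu> :: "nat \<Rightarrow> 'a::del_module \<Rightarrow> 'a \<Rightarrow> 'a poly"
  assumes conf: "\<And>r. conformal_algebra UNIV (\<mu> r)"
begin

text \<open>Conformality holds on all of $A[[\hbar]]$, not only on truncated series, which gives access to the
  calculus of brackets with polynomial arguments.\<close>

lemma conformal_hbar_op: "conformal_algebra UNIV (hbar_op n \<mu>)"
  unfolding conformal_algebra_def
proof (intro conjI allI ballI UNIV_I)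
  show "submodule UNIV" by (simp add: submodule_def)
qed (intro poly_eqI fps_ext,
    simp add: hbar_op_nth coeff_map_poly fps_nth_scaleC fps_nth_del coeff_pCons split: nat.split,
    simp add: conformal_add_left[OF conf] conformal_add_right[OF conf] conformal_scaleC_left[OF conf]
      conformal_scaleC_right[OF conf] conformal_del_left[OF conf] conformal_del_right[OF conf]
      coeff_map_poly split_def sum.distrib complex_linear_sum[OF complex_linear_scaleC_fun]
      complex_linear_sum[OF complex_linear_del] coeff_pCons sum_negf split: nat.split)+

lemma hbar_coeff_lbr:
  "hbar_coeff N (lbr (hbar_op n \<mu>) p F G) =
    (if N \<le> n then \<Sum>(i, j, k)\<in>{(i, j, k). i + j + k = N}. lbr (\<mu> k) p (hbar_coeff i F) (hbar_coeff j G) else 0)"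
proof (induction F rule: mpoly_induct)
  case (single u f)
  show ?case
  proof (induction G rule: mpoly_induct)
    case (single v g)
    have "map_poly (\<lambda>f. fps_nth f N) (hbar_op n \<mu> f g) =
      (if N \<le> n then \<Sum>(i, j, k)\<in>{(i, j, k). i + j + k = N}. \<mu> k (fps_nth f i) (fps_nth g j) else 0)"
      by (intro poly_eqI) (simp add: coeff_map_poly hbar_op_nth coeff_sum split_def)
    then show ?case
      by (simp add: lbr_single[OF conformal_hbar_op] lbr_single[OF conf] mpoly_map_act complex_linear_fps_nth
          poly_at_map_poly[symmetric] poly_at_sum act_sum_right split_def when_def)
  qed (simp_all add: hbar_coeff_add lbr_add_right[OF conf] lbr_add_right[OF conformal_hbar_op] split_def sum.distrib)
qed (simp_all add: hbar_coeff_add lbr_add_left[OF conf] lbr_add_left[OF conformal_hbar_op] split_def sum.distrib)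

lemma hbar_coeff_associativity:
  assumes "N \<le> n"
  shows "hbar_coeff N (lbr (hbar_op n \<mu>) (p + q) (lbr (hbar_op n \<mu>) p F G) H)
      - hbar_coeff N (lbr (hbar_op n \<mu>) p F (lbr (hbar_op n \<mu>) q G H)) =
    (\<Sum>(i, j, l, e)\<in>{(i, j, l, e). i + j + l + e = N}.
      associator \<mu> e p q (hbar_coeff i F) (hbar_coeff j G) (hbar_coeff l H))"
proof -
  have "hbar_coeff N (lbr (hbar_op n \<mu>) (p + q) (lbr (hbar_op n \<mu>) p F G) H) =
    (\<Sum>(h, l, r)\<in>{(h, l, r). h + l + r = N}. \<Sum>(i, j, s)\<in>{(i, j, s). i + j + s = h}.
      lbr (\<mu> r) (p + q) (lbr (\<mu> s) p (hbar_coeff i F) (hbar_coeff j G)) (hbar_coeff l H))"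
    using assms by (auto intro!: sum.cong simp: hbar_coeff_lbr lbr_sum_left[OF conf] split_def)
  moreover have "hbar_coeff N (lbr (hbar_op n \<mu>) p F (lbr (hbar_op n \<mu>) q G H)) =
    (\<Sum>(i, h, r)\<in>{(i, h, r). i + h + r = N}. \<Sum>(j, l, s)\<in>{(j, l, s). j + l + s = h}.
      lbr (\<mu> r) p (hbar_coeff i F) (lbr (\<mu> s) q (hbar_coeff j G) (hbar_coeff l H)))"
    using assms by (auto intro!: sum.cong simp: hbar_coeff_lbr lbr_sum_right[OF conf] split_def)
  ultimately show ?thesis
    unfolding sum_split_left sum_split_right associator_def sum_split_brackets
    by (simp add: quintuple_sum_def sum_subtractf split_def)
qed

text \<open>Constant series isolate a single associator; conversely every coefficient of the associativity
  defect is a sum of associators of order at most \<open>n\<close>.\<close>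

lemma hbar_op_associative_iff:
  "associative_conformal_algebra (truncated n) (hbar_op n \<mu>) \<longleftrightarrow>
    (\<forall>N\<le>n. \<forall>a b c. associator \<mu> N (lam 0) (lam 1) (cst a) (cst b) (cst c) = 0)"
proof (intro iffI allI impI)
  fix N a b c
  assume assoc: "associative_conformal_algebra (truncated n) (hbar_op n \<mu>)" and N: "N \<le> n"
  have t: "hbar_times 0 x \<in> truncated n" for x :: 'a
    by (simp add: hbar_times_def truncated_def)
  have nth: "fps_nth (hbar_times 0 x) i = (if i = 0 then x else 0)" for x :: 'a and i
    by (simp add: hbar_times_def)
  note lin = scalar_linear_zero[OF scalar_linear_associator(1)[OF conf]]
    scalar_linear_zero[OF scalar_linear_associator(2)[OF conf]]
    scalar_linear_zero[OF scalar_linear_associator(3)[OF conf]]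
  have "lbr (hbar_op n \<mu>) (lam 0) (cst f) (lbr (hbar_op n \<mu>) (lam 1) (cst g) (cst h)) =
      lbr (hbar_op n \<mu>) (lam 0 + lam 1) (lbr (hbar_op n \<mu>) (lam 0) (cst f) (cst g)) (cst h)"
    if "f \<in> truncated n" "g \<in> truncated n" "h \<in> truncated n" for f g h
    using assoc that unfolding associative_conformal_algebra_def by blast
  from this[OF t t t, of a b c] have "0 = (\<Sum>(i, j, l, e)\<in>{(i, j, l, e). i + j + l + e = N}. associator \<mu> e (lam 0) (lam 1)
      (hbar_coeff i (cst (hbar_times 0 a))) (hbar_coeff j (cst (hbar_times 0 b))) (hbar_coeff l (cst (hbar_times 0 c))))"
    by (simp only: hbar_coeff_associativity[OF N, symmetric] diff_self)
  also have "\<dots> = (\<Sum>(i, j, l, e)\<in>{(0::nat, 0::nat, 0::nat, N)}. associator \<mu> e (lam 0) (lam 1) (cst a) (cst b) (cst c))"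
    by (rule sum.mono_neutral_cong_right) (auto simp: hbar_coeff_cst nth lin split: if_splits)
  finally show "associator \<mu> N (lam 0) (lam 1) (cst a) (cst b) (cst c) = 0"
    by simp
next
  assume *: "\<forall>N\<le>n. \<forall>a b c. associator \<mu> N (lam 0) (lam 1) (cst a) (cst b) (cst c) = 0"
  have "conformal_algebra (truncated n) (hbar_op n \<mu>)"
    by (rule conformal_algebra_subset[OF conformal_hbar_op submodule_truncated])
      (simp add: truncated_def hbar_op_nth)
  moreover have "lbr (hbar_op n \<mu>) p F (lbr (hbar_op n \<mu>) q G H) =
      lbr (hbar_op n \<mu>) (p + q) (lbr (hbar_op n \<mu>) p F G) H" for p q F G H
  proof (rule hbar_coeff_eqI)
    fix N
    show "hbar_coeff N (lbr (hbar_op n \<mu>) p F (lbr (hbar_op n \<mu>) q G H)) =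
      hbar_coeff N (lbr (hbar_op n \<mu>) (p + q) (lbr (hbar_op n \<mu>) p F G) H)"
    proof (cases "N \<le> n")
      case True
      have "(\<Sum>(i, j, l, e)\<in>{(i, j, l, e). i + j + l + e = N}.
          associator \<mu> e p q (hbar_coeff i F) (hbar_coeff j G) (hbar_coeff l H)) = 0"
      proof (rule sum.neutral, clarify)
        fix i j l e
        assume "N = i + j + l + e"
        then have "e \<le> n" using True by simp
        then have "associator \<mu> e (lam 0) (lam 1) (cst a) (cst b) (cst c) = 0" for a b c
          using * by blast
        then show "associator \<mu> e p q (hbar_coeff i F) (hbar_coeff j G) (hbar_coeff l H) = 0"
          by (rule associator_eq_zero[OF conf])
      qed
      then show ?thesis
        using hbar_coeff_associativity[OF True, of p q F G H] by simp
    qed (simp add: hbar_coeff_lbr)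
  qed
  ultimately show "associative_conformal_algebra (truncated n) (hbar_op n \<mu>)"
    unfolding associative_conformal_algebra_def by blast
qed

end

section \<open>Two-cochains and conformal brackets\<close>

definition mpoly_to_poly :: "'a::comm_monoid_add mpoly \<Rightarrow> 'a poly" where
  "mpoly_to_poly F = (\<Sum>u\<in>Poly_Mapping.keys F. monom (Poly_Mapping.lookup F u) (Poly_Mapping.lookup u 0))"

lemma lam_power: "lam i ^ j = Poly_Mapping.single (Poly_Mapping.single i j) 1"
  by (induction j) (simp_all add: lam_def mult_single single_add[symmetric])

lemma lookup_poly_at_lam: "Poly_Mapping.lookup (poly_at (lam 0) P) (Poly_Mapping.single 0 j) = coeff P j"
proof -
  have "(Poly_Mapping.single (0::nat) j = Poly_Mapping.single 0 k) \<longleftrightarrow> j = k" for j k :: nat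
    by (metis lookup_single_eq)
  then show ?thesis
    by (auto simp: poly_at_def lam_power single_eq_act_cst[symmetric] lookup_sum lookup_single when_def coeff_eq_0)
qed

lemma poly_at_lam_inject: "poly_at (lam 0) P = poly_at (lam 0) Q \<Longrightarrow> P = Q"
  by (intro poly_eqI) (metis lookup_poly_at_lam)

lemma poly_at_monom: "poly_at p (monom a j) = p ^ j \<bullet> cst a"
proof -
  have "poly_at p (monom a j) = (\<Sum>i\<le>j. p ^ i \<bullet> cst (coeff (monom a j) i))"
    by (rule poly_at_superset) (rule degree_monom_le)
  also have "\<dots> = (\<Sum>i\<le>j. if i = j then p ^ j \<bullet> cst a else 0)"
    by (intro sum.cong) (auto simp: coeff_monom)
  finally show ?thesis by simp
qed

lemma poly_at_mpoly_to_poly: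
  assumes "variables_below 1 F"
  shows "poly_at (lam 0) (mpoly_to_poly F) = F"
proof -
  have "u = Poly_Mapping.single 0 (Poly_Mapping.lookup u 0)" if "u \<in> Poly_Mapping.keys F" for u
  proof (rule poly_mapping_eqI)
    fix k
    have "k \<notin> Poly_Mapping.keys u" if "k \<noteq> 0"
      using assms that \<open>u \<in> Poly_Mapping.keys F\<close> by (auto simp: variables_below_def)
    then show "Poly_Mapping.lookup u k = Poly_Mapping.lookup (Poly_Mapping.single 0 (Poly_Mapping.lookup u 0)) k"
      by (cases "k = 0") (auto simp: lookup_single in_keys_iff)
  qed
  then have "poly_at (lam 0) (mpoly_to_poly F) =
      (\<Sum>u\<in>Poly_Mapping.keys F. Poly_Mapping.single u (Poly_Mapping.lookup F u))"
    by (simp add: mpoly_to_poly_def poly_at_sum poly_at_monom lam_power single_eq_act_cst[symmetric])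
  then show ?thesis
    by (simp add: mpoly_sum_single[symmetric])
qed

text \<open>A $2$-cochain involves the variable \<open>lam 0\<close> only, so its values are polynomials in one variable, and
  the cochain conditions become the axioms of a conformal algebra. Hence a cochain bounding the
  obstruction is the same thing as a candidate for the next term of the deformation.\<close>

lemma cochains_2_eq: "cochains 2 = bracket_cochain ` {\<nu>. conformal_algebra UNIV \<nu>}"
proof (intro equalityI subsetI)
  fix \<gamma> :: "'a list \<Rightarrow> 'a mpoly" assume \<gamma>: "\<gamma> \<in> cochains 2"
  define \<nu> where "\<nu> a b = mpoly_to_poly (\<gamma> [a, b])" for a b
  have zero: "\<gamma> as = 0" if "length as \<noteq> 2" for as
    using \<gamma> that by (simp add: cochains_def)
  have axioms: "(\<forall>u\<in>Poly_Mapping.keys (\<gamma> as). Poly_Mapping.keys u \<subseteq> {..<1}) \<and>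
        (\<forall>i<2. \<forall>x y. \<gamma> (as[i := x + y]) = \<gamma> (as[i := x]) + \<gamma> (as[i := y])) \<and>
        (\<forall>i<2. \<forall>c x. \<gamma> (as[i := c *\<^sub>C x]) = Poly_Mapping.map ((*\<^sub>C) c) (\<gamma> (as[i := x]))) \<and>
        \<gamma> (as[0 := \<partial> (as ! 0)]) = (- lam 0) \<bullet> \<gamma> as \<and>
        \<gamma> (as[1 := \<partial> (as ! 1)]) = lam 0 \<bullet> \<gamma> as + mpoly_del (\<gamma> as)" if "length as = 2" for as
    using \<gamma> that by (simp add: cochains_def)
  have \<nu>: "poly_at (lam 0) (\<nu> a b) = \<gamma> [a, b]" for a b
    unfolding \<nu>_def
    by (rule poly_at_mpoly_to_poly) (use axioms[of "[a, b]"] in \<open>simp add: variables_below_def\<close>)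
  have left: "\<gamma> [x + y, b] = \<gamma> [x, b] + \<gamma> [y, b]" "\<gamma> [c *\<^sub>C x, b] = Poly_Mapping.map ((*\<^sub>C) c) (\<gamma> [x, b])"
    "\<gamma> [\<partial> x, b] = (- lam 0) \<bullet> \<gamma> [x, b]" for x y b c
    using axioms[of "[x, b]"] by (auto simp: less_2_cases_iff)
  have right: "\<gamma> [a, x + y] = \<gamma> [a, x] + \<gamma> [a, y]" "\<gamma> [a, c *\<^sub>C x] = Poly_Mapping.map ((*\<^sub>C) c) (\<gamma> [a, x])"
    "\<gamma> [a, \<partial> x] = lam 0 \<bullet> \<gamma> [a, x] + mpoly_del (\<gamma> [a, x])" for x y a c
    using axioms[of "[a, x]"] by (auto simp: less_2_cases_iff)
  have conf: "conformal_algebra UNIV \<nu>"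
    unfolding conformal_algebra_def
  proof (intro conjI allI ballI UNIV_I)
    show "submodule (UNIV :: 'a set)" by (simp add: submodule_def)
  qed (rule poly_at_lam_inject,
      simp add: \<nu> left right poly_at_add poly_at_minus poly_at_pCons poly_at_del act_minus_left act_minus_right
        poly_at_map_poly complex_linear_scaleC_fun add.commute)+
  moreover have "\<gamma> = bracket_cochain \<nu>"
  proof
    fix as
    show "\<gamma> as = bracket_cochain \<nu> as"
    proof (cases "length as = 2")
      case True
      then show ?thesis
        by (auto simp: bracket_cochain_def lbr_cst[OF conf] \<nu> elim: length_2E)
    next
      case False
      then show ?thesis
        using zero bracket_cochain_in_cochains[OF conf] by (simp add: cochains_def)
    qed
  qed
  ultimately show "\<gamma> \<in> bracket_cochain ` {\<nu>. conformal_algebra UNIV \<nu>}" by blast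
qed (auto simp: bracket_cochain_in_cochains)

section \<open>Cohomology classes and the extension theorem\<close>

lemma cochains_diff:
  assumes "\<phi> \<in> cochains k" "\<psi> \<in> cochains k"
  shows "(\<lambda>as. \<phi> as - \<psi> as) \<in> cochains k"
proof -
  have "variables_below (k - 1) (\<phi> as - \<psi> as)" if "length as = k" for as
    using assms that by (intro variables_below_diff) (auto simp: cochains_def variables_below_def)
  then show ?thesis
    using assms by (simp add: cochains_def variables_below_def mpoly_map_scaleC act_diff_right mpoly_del_diff)
qed

lemma zero_in_cochains: "(\<lambda>_. 0) \<in> cochains k"
  by (simp add: cochains_def)

lemma dH_diff:
  assumes "conformal_algebra UNIV m"
  shows "dH m k (\<lambda>as. \<phi> as - \<psi> as) as = dH m k \<phi> as - dH m k \<psi> as"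
  by (simp add: dH_def Let_def msubst_diff act_diff_right sum_subtractf lbr_diff_left[OF assms] lbr_diff_right[OF assms])

lemma dH_zero: "dH m k (\<lambda>_. 0) = (\<lambda>_. 0)"
  by (rule ext) (simp add: dH_def)

text \<open>The coboundaries are closed under differences, so the class of a cocycle is zero exactly if
  it is a coboundary.\<close>

lemma cohomology_class_eq_zero_iff:
  assumes "conformal_algebra UNIV m" "\<gamma> \<in> cocycles m k"
  shows "cohomology_class m k \<gamma> = cohomology_class m k (\<lambda>_. 0) \<longleftrightarrow> \<gamma> \<in> coboundaries m k"
proof -
  have zero: "(\<lambda>_. 0) \<in> cocycles m k" "(\<lambda>_. 0) \<in> coboundaries m k"
    using zero_in_cochains dH_zero[of m] by (auto simp: cocycles_def coboundaries_def image_iff fun_eq_iff intro: bexI[of _ "\<lambda>_. 0"])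
  have diff: "(\<lambda>as. \<phi> as - \<psi> as) \<in> coboundaries m k" if "\<phi> \<in> coboundaries m k" "\<psi> \<in> coboundaries m k" for \<phi> \<psi>
    using that unfolding coboundaries_def
    by (auto simp: dH_diff[OF assms(1), symmetric] intro!: imageI cochains_diff)
  show ?thesis
  proof
    assume "cohomology_class m k \<gamma> = cohomology_class m k (\<lambda>_. 0)"
    moreover have "(\<lambda>_. 0) \<in> cohomology_class m k (\<lambda>_. 0)"
      using zero by (simp add: cohomology_class_def cohomologous_def)
    ultimately have "(\<lambda>_. 0) \<in> cohomology_class m k \<gamma>"
      by simp
    then show "\<gamma> \<in> coboundaries m k"
      by (simp add: cohomology_class_def cohomologous_def)
  next
    assume \<gamma>: "\<gamma> \<in> coboundaries m k"
    have "(\<lambda>as. \<gamma> as - \<phi> as) \<in> coboundaries m k \<longleftrightarrow> (\<lambda>as. 0 - \<phi> as) \<in> coboundaries m k" for \<phi>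
      using diff[OF _ \<gamma>, of "\<lambda>as. \<gamma> as - \<phi> as"] diff[OF \<gamma> diff[OF zero(2)], of "\<lambda>as. 0 - \<phi> as"] by auto
    then show "cohomology_class m k \<gamma> = cohomology_class m k (\<lambda>_. 0)"
      using assms(2) zero by (auto simp: cohomology_class_def cohomologous_def)
  qed
qed

theorem theorem4p13:
  fixes m :: "'a::del_module \<Rightarrow> 'a \<Rightarrow> 'a poly"
    and \<mu> :: "nat \<Rightarrow> 'a \<Rightarrow> 'a \<Rightarrow> 'a poly"
    and n :: nat
  assumes "associative_conformal_algebra UNIV m"
    and "commutative_on UNIV m"
    and "n \<ge> 1"
    and "conformal_deformation m n \<mu>"
  shows "theta n \<mu> \<in> cochains 3
    \<and> dH m 3 (theta n \<mu>) = (\<lambda>_. 0)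
    \<and> ((\<exists>\<mu>'. extension_of m n \<mu> \<mu>')
       \<longleftrightarrow> cohomology_class m 3 (theta n \<mu>) = cohomology_class m 3 (\<lambda>_. 0))"
proof -
  let ?\<nu> = "truncate_brackets n \<mu>"
  have \<mu>0: "\<mu> 0 = m" and conf: "\<And>r. r \<le> n \<Longrightarrow> conformal_algebra UNIV (\<mu> r)"
    and assoc: "associative_conformal_algebra (truncated n) (hbar_op n \<mu>)"
    using assms(4) by (simp_all add: conformal_deformation_def)
  have m: "conformal_algebra UNIV m"
    using conf[of 0] \<mu>0 by simp
  have \<nu>: "conformal_algebra UNIV (?\<nu> r)" for r
    by (rule conformal_truncate_brackets) (rule conf)
  have \<nu>_eq: "?\<nu> r = \<mu> r" if "r \<le> n" for r
    using that by (simp add: truncate_brackets_def)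
  have flat: "associator ?\<nu> N (lam 0) (lam 1) (cst a) (cst b) (cst c) = 0" if "N \<le> n" for N a b c
    using hbar_op_associative_iff[of ?\<nu> n, OF \<nu>] hbar_op_cong[of n ?\<nu> \<mu>, OF \<nu>_eq] assoc that by simp
  have cochain: "theta n \<mu> \<in> cochains 3"
    by (rule theta_in_cochains) (rule conf)
  have "dH m 3 (theta n \<mu>) as = 0" for as
  proof (cases "length as = 4")
    case True
    then obtain a b c d where "as = [a, b, c, d]" by (rule length_4E)
    moreover have "dH m 3 (theta n \<mu>) [a, b, c, d] = 0"
    proof (rule dH_associator[of ?\<nu> _ "Suc n", OF \<nu>])
      show "theta n \<mu> [a, b, c] = associator ?\<nu> (Suc n) (lam 0) (lam 1) (cst a) (cst b) (cst c)" for a b c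
        by (rule theta_eq_associator) (rule conf)
    qed (use flat in \<open>auto simp: \<nu>_eq \<mu>0\<close>)
    ultimately show ?thesis by simp
  qed (simp add: dH_def)
  then have closed: "dH m 3 (theta n \<mu>) = (\<lambda>_. 0)" by blast
  have "(\<exists>\<mu>'. extension_of m n \<mu> \<mu>') \<longleftrightarrow> theta n \<mu> \<in> coboundaries m 3"
  proof
    assume "\<exists>\<mu>'. extension_of m n \<mu> \<mu>'"
    then obtain \<mu>' where \<mu>': "\<mu>' 0 = m" "\<And>r. r \<le> Suc n \<Longrightarrow> conformal_algebra UNIV (\<mu>' r)"
      "associative_conformal_algebra (truncated (Suc n)) (hbar_op (Suc n) \<mu>')" "\<And>r. r \<le> n \<Longrightarrow> \<mu>' r = \<mu> r"
      unfolding extension_of_def conformal_deformation_def by blast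
    let ?\<rho> = "truncate_brackets (Suc n) \<mu>'"
    have \<rho>: "conformal_algebra UNIV (?\<rho> r)" for r
      by (rule conformal_truncate_brackets) (rule \<mu>'(2))
    have \<rho>_eq: "?\<rho> r = \<mu>' r" if "r \<le> Suc n" for r
      using that by (simp add: truncate_brackets_def)
    have "associator ?\<rho> (Suc n) (lam 0) (lam 1) (cst a) (cst b) (cst c) = 0" for a b c
      using hbar_op_associative_iff[of ?\<rho> "Suc n", OF \<rho>] hbar_op_cong[of "Suc n" ?\<rho> \<mu>', OF \<rho>_eq] \<mu>'(3) by simp
    moreover have "theta n ?\<rho> = theta n \<mu>"
      by (rule theta_cong) (simp add: \<rho>_eq \<mu>'(4))
    ultimately have eq: "theta n \<mu> [a, b, c] = dH m 2 (bracket_cochain (\<mu>' (Suc n))) [a, b, c]" for a b c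
      using associator_eq_theta_minus_dH[of ?\<rho> n a b c, OF \<rho>] by (simp add: \<rho>_eq \<mu>'(1))
    have "theta n \<mu> = dH m 2 (bracket_cochain (\<mu>' (Suc n)))"
    proof
      fix as
      show "theta n \<mu> as = dH m 2 (bracket_cochain (\<mu>' (Suc n))) as"
      proof (cases "length as = 3")
        case True
        then show ?thesis using eq by (auto elim: length_3E)
      next
        case False
        then show ?thesis using cochain by (simp add: cochains_def dH_def)
      qed
    qed
    then show "theta n \<mu> \<in> coboundaries m 3"
      using bracket_cochain_in_cochains[OF \<mu>'(2)[of "Suc n"]] by (simp add: coboundaries_def)
  next
    assume "theta n \<mu> \<in> coboundaries m 3"
    then obtain \<rho> where \<rho>: "conformal_algebra UNIV \<rho>" and eq: "theta n \<mu> = dH m 2 (bracket_cochain \<rho>)"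
      by (auto simp: coboundaries_def cochains_2_eq)
    let ?\<mu>' = "?\<nu>(Suc n := \<rho>)"
    have \<mu>': "conformal_algebra UNIV (?\<mu>' r)" for r
      by (simp add: \<nu> \<rho>)
    have "associator ?\<mu>' N (lam 0) (lam 1) (cst a) (cst b) (cst c) = 0" if "N \<le> Suc n" for N a b c
    proof (cases "N = Suc n")
      case True
      have "theta n ?\<mu>' = theta n \<mu>"
        by (rule theta_cong) (simp add: \<nu>_eq)
      then show ?thesis
        using associator_eq_theta_minus_dH[of ?\<mu>' n a b c, OF \<mu>'] True by (simp add: \<nu>_eq \<mu>0 eq)
    next
      case False
      then have "associator ?\<mu>' N = associator ?\<nu> N"
        using that by (intro associator_cong) auto
      then show ?thesis
        using flat[of N] that False by simp
    qed
    then have "associative_conformal_algebra (truncated (Suc n)) (hbar_op (Suc n) ?\<mu>')"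
      using hbar_op_associative_iff[of ?\<mu>' "Suc n", OF \<mu>'] by blast
    then have "extension_of m n \<mu> ?\<mu>'"
      using \<mu>' unfolding extension_of_def conformal_deformation_def by (simp add: \<nu>_eq \<mu>0)
    then show "\<exists>\<mu>'. extension_of m n \<mu> \<mu>'" by blast
  qed
  then show ?thesis
    using cochain closed cohomology_class_eq_zero_iff[OF m, of "theta n \<mu>" 3] by (simp add: cocycles_def)
qed

end
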